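(* Let $\mathcal{T}$ be a triangulated category. (1) Let $X\xrightarrow{u}Y\xrightarrow{v}Z\xrightarrow{w}\Sigma X$ and $$X\oplus X''\xrightarrow{\begin{bmatrix}u&c \\ 0&u''\end{bmatrix}}Y\oplus Y''\xrightarrow{\begin{bmatrix}v_1'&v_2'\end{bmatrix}}Z'\xrightarrow{\begin{bmatrix} w_1' \\ w_2' \end{bmatrix}}\Sigma X\oplus\Sigma X''$$ be exact triangles, and let $(\mathrm{inc},\mathrm{inc},h)$ be a map of triangles from the first to the second, where $\mathrm{inc}\colon X\to X\oplus X''$ and $\mathrm{inc}\colon Y\to Y\oplus Y''$ are the inclusions of the first summands and $h\colon Z\to Z'$. The following are equivalent: (a) The map is good. (b) The map is Verdier good. (c) The following diagram is an exact triangle: $$X''\xrightarrow{\begin{bmatrix} vc \\ u'' \end{bmatrix}}Z\oplus Y''\xrightarrow{\begin{bmatrix}h&v_2'\end{bmatrix}}Z'\xrightarrow{w_2'}\Sigma X''.$$ When $c=0$, these three conditions hold for any $h$ (making $(\mathrm{inc},\mathrm{inc},h)$ a map of triangles). (2) Similarly, let $$X\oplus X''\xrightarrow{\begin{bmatrix}u&c \\ 0&u''\end{bmatrix}}Y\oplus Y''\xrightarrow{\begin{bmatrix}v_1'&v_2'\end{bmatrix}}Z'\xrightarrow{\begin{bmatrix} w_1' \\ w_2' \end{bmatrix}}\Sigma X\oplus\Sigma X''\quad\text{and}\quad X''\xrightarrow{u''}Y''\xrightarrow{v''}Z''\xrightarrow{w''}\Sigma X''$$ be exact triangles, and let $(\mathrm{proj},\mathrm{proj},h)$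 be a map of triangles from the first to the second, where $\mathrm{proj}\colon X\oplus X''\to X''$ and $\mathrm{proj}\colon Y\oplus Y''\to Y''$ are the projections onto the second summands and $h\colon Z'\to Z''$. This map is good if and only if it is Verdier good, if and only if the following diagram is an exact triangle: $$Z'\xrightarrow{\begin{bmatrix} w_1' \\ h \end{bmatrix}}\Sigma X\oplus Z''\xrightarrow{\begin{bmatrix}\Sigma u&(\Sigma c)w''\end{bmatrix}}\Sigma Y\xrightarrow{\Sigma v_1'}\Sigma Z'.$$ These conditions hold when $c=0$.
   Context: $\mathcal{T}$ is a triangulated category with self-equivalence $\Sigma$. "Exact triangle" or "triangle" means distinguished triangle. Matrices act on column vectors. A map of triangles $(f,g,h)$ from $X\xrightarrow{u}Y\xrightarrow{v}Z\xrightarrow{w}\Sigma X$ to $X'\xrightarrow{u'}Y'\xrightarrow{v'}Z'\xrightarrow{w'}\Sigma X'$ consists of $f\colon X\to X'$, $g\colon Y\to Y'$, $h\colon Z\to Z'$ with $gu=u'f$, $hv=v'g$, $(\Sigma f)w=w'h$. The mapping cone of $(f,g,h)$ is the sequence $X'\oplus Y\to Y'\oplus Z\to Z'\oplus\Sigma X\to\Sigma X'\oplus\Sigma Y$ with successive maps $\begin{bmatrix}u'&g \\ 0&-v\end{bmatrix},\begin{bmatrix}v'&h \\ 0&-w\end{bmatrix},\begin{bmatrix}w'&\Sigma f \\ 0&-\Sigma u\end{bmatrix}$. $(f,g,h)$ is good if its mapping cone is an exact triangle. Octahedra: given composable maps $P\xrightarrow{a}Q\xrightarrow{b}R$ and exact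 triangles $P\xrightarrow{a}Q\xrightarrow{a'}C_a\xrightarrow{a''}\Sigma P$, $Q\xrightarrow{b}R\xrightarrow{b'}C_b\xrightarrow{b''}\Sigma Q$, $P\xrightarrow{ba}R\xrightarrow{c'}C\xrightarrow{c''}\Sigma P$, an octahedron for the composite $ba$ consists of maps $\alpha\colon C_a\to C$, $\beta\colon C\to C_b$, $\gamma\colon C_b\to\Sigma C_a$ such that $C_a\xrightarrow{\alpha}C\xrightarrow{\beta}C_b\xrightarrow{\gamma}\Sigma C_a$ is exact and $\alpha a'=c'b$, $c''\alpha=a''$, $\beta c'=b'$, $\gamma=(\Sigma a')b''$, $b''\beta=(\Sigma a)c''$. Verdier good (for a general map of triangles $(f,g,h)$ from $X\xrightarrow{u}Y\xrightarrow{v}Z\xrightarrow{w}\Sigma X$ to $X'\xrightarrow{u'}Y'\xrightarrow{v'}Z'\xrightarrow{w'}\Sigma X'$): choose exact triangles $X\xrightarrow{f}X'\xrightarrow{f'}X''\xrightarrow{f''}\Sigma X$, $Y\xrightarrow{g}Y'\xrightarrow{g'}Y''\xrightarrow{g''}\Sigma Y$ and $X\xrightarrow{gu=u'f}Y'\xrightarrow{\tilde v}A\xrightarrow{\tilde w}\Sigma X$. The map $(f,g,h)$ is Verdier good if there exist an octahedron $(\alpha_1\colon Z\to A,\ \beta_1\colon A\to Y'',\ \gamma_1)$ for the composite $X\xrightarrow{u}Y\xrightarrow{g}Y'$ and an octahedron $(\alpha_2\colon X''\to A,\ \beta_2\colon A\to Z',\ \gamma_2)$ for the composite $X\xrightarrow{f}X'\xrightarrow{u'}Y'$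 (both using the given and chosen triangles, in particular the same triangle on $gu=u'f$) such that $h=\beta_2\alpha_1$. This does not depend on the chosen triangles. (The letters in these general definitions are generic and independent of those in the claim.) *)

theory Defs
  imports "HOL-Algebra.Group"
begin

section \<open>Categories, functors and equivalences\<close>

text \<open>Morphisms know their source and target, so hom-sets are disjoint. Composition is
  only meaningful for composable morphisms and is written in the usual (right-to-left) order.\<close>

record ('o, 'a) cat =
  Obj :: "'o set"
  Arr :: "'a set"
  src :: "'a \<Rightarrow> 'o"
  tgt :: "'a \<Rightarrow> 'o"
  ident :: "'o \<Rightarrow> 'a"
  cmp :: "'a \<Rightarrow> 'a \<Rightarrow> 'a"  (infixr "\<cdot>\<index>" 75)

definition Hom :: "('o, 'a, 'm) cat_scheme \<Rightarrow> 'o \<Rightarrow> 'o \<Rightarrow> 'a set" where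
  "Hom C A B = {f \<in> Arr C. src C f = A \<and> tgt C f = B}"

locale category =
  fixes C :: "('o, 'a, 'm) cat_scheme" (structure)
  assumes src_Obj: "f \<in> Arr C \<Longrightarrow> src C f \<in> Obj C"
    and tgt_Obj: "f \<in> Arr C \<Longrightarrow> tgt C f \<in> Obj C"
    and ident_Hom: "A \<in> Obj C \<Longrightarrow> ident C A \<in> Hom C A A"
    and cmp_Hom: "\<lbrakk>f \<in> Hom C A B; g \<in> Hom C B D\<rbrakk> \<Longrightarrow> g \<cdot> f \<in> Hom C A D"
    and cmp_ident: "f \<in> Hom C A B \<Longrightarrow> f \<cdot> ident C A = f"
    and ident_cmp: "f \<in> Hom C A B \<Longrightarrow> ident C B \<cdot> f = f"
    and cmp_assoc: "\<lbrakk>f \<in> Hom C A B; g \<in> Hom C B D; h \<in> Hom C D E\<rbrakk>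
                      \<Longrightarrow> (h \<cdot> g) \<cdot> f = h \<cdot> (g \<cdot> f)"

definition is_iso :: "('o, 'a, 'm) cat_scheme \<Rightarrow> 'a \<Rightarrow> bool" where
  "is_iso C f \<longleftrightarrow> f \<in> Arr C \<and>
     (\<exists>g \<in> Hom C (tgt C f) (src C f).
        g \<cdot>\<^bsub>C\<^esub> f = ident C (src C f) \<and> f \<cdot>\<^bsub>C\<^esub> g = ident C (tgt C f))"

definition is_functor ::
  "('o, 'a, 'm) cat_scheme \<Rightarrow> ('p, 'b, 'n) cat_scheme \<Rightarrow> ('o \<Rightarrow> 'p) \<Rightarrow> ('a \<Rightarrow> 'b) \<Rightarrow> bool" where
  "is_functor C D Fo Fa \<longleftrightarrow>
     (\<forall>A \<in> Obj C. Fo A \<in> Obj D \<and> Fa (ident C A) = ident D (Fo A)) \<and>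
     (\<forall>A B f. f \<in> Hom C A B \<longrightarrow> Fa f \<in> Hom D (Fo A) (Fo B)) \<and>
     (\<forall>A B E f g. f \<in> Hom C A B \<longrightarrow> g \<in> Hom C B E \<longrightarrow> Fa (g \<cdot>\<^bsub>C\<^esub> f) = Fa g \<cdot>\<^bsub>D\<^esub> Fa f)"

definition is_nat_iso ::
  "('o, 'a, 'm) cat_scheme \<Rightarrow> ('p, 'b, 'n) cat_scheme \<Rightarrow> ('o \<Rightarrow> 'p) \<Rightarrow> ('a \<Rightarrow> 'b)
     \<Rightarrow> ('o \<Rightarrow> 'p) \<Rightarrow> ('a \<Rightarrow> 'b) \<Rightarrow> ('o \<Rightarrow> 'b) \<Rightarrow> bool" where
  "is_nat_iso C D Fo Fa Go Ga \<eta> \<longleftrightarrow>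
     (\<forall>A \<in> Obj C. \<eta> A \<in> Hom D (Fo A) (Go A) \<and> is_iso D (\<eta> A)) \<and>
     (\<forall>A B f. f \<in> Hom C A B \<longrightarrow> \<eta> B \<cdot>\<^bsub>D\<^esub> Fa f = Ga f \<cdot>\<^bsub>D\<^esub> \<eta> A)"

definition is_equivalence ::
  "('o, 'a, 'm) cat_scheme \<Rightarrow> ('p, 'b, 'n) cat_scheme \<Rightarrow> ('o \<Rightarrow> 'p) \<Rightarrow> ('a \<Rightarrow> 'b) \<Rightarrow> bool" where
  "is_equivalence C D Fo Fa \<longleftrightarrow> is_functor C D Fo Fa \<and>
     (\<exists>Go Ga \<eta> \<epsilon>. is_functor D C Go Ga \<and>
        is_nat_iso C C (\<lambda>A. A) (\<lambda>f. f) (\<lambda>A. Go (Fo A)) (\<lambda>f. Ga (Fa f)) \<eta> \<and>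
        is_nat_iso D D (\<lambda>B. Fo (Go B)) (\<lambda>g. Fa (Ga g)) (\<lambda>B. B) (\<lambda>g. g) \<epsilon>)"


section \<open>Additive categories\<close>

text \<open>A zero object and a direct sum for every pair of objects are part of the structure;
  they are arbitrary choices. \<open>zarr C A B\<close> is the zero morphism from \<open>A\<close> to \<open>B\<close>.\<close>

record ('o, 'a) addcat = "('o, 'a) cat" +
  madd :: "'a \<Rightarrow> 'a \<Rightarrow> 'a"  (infixl "\<boxplus>\<index>" 65)
  zarr :: "'o \<Rightarrow> 'o \<Rightarrow> 'a"
  zobj :: "'o"
  osum :: "'o \<Rightarrow> 'o \<Rightarrow> 'o"  (infixl "\<oplus>\<index>" 65)
  inl :: "'o \<Rightarrow> 'o \<Rightarrow> 'a"
  inr :: "'o \<Rightarrow> 'o \<Rightarrow> 'a"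
  prl :: "'o \<Rightarrow> 'o \<Rightarrow> 'a"
  prr :: "'o \<Rightarrow> 'o \<Rightarrow> 'a"

definition hom_group :: "('o, 'a, 'm) addcat_scheme \<Rightarrow> 'o \<Rightarrow> 'o \<Rightarrow> 'a monoid" where
  "hom_group C A B = \<lparr>carrier = Hom C A B, monoid.mult = madd C, one = zarr C A B\<rparr>"

definition neg :: "('o, 'a, 'm) addcat_scheme \<Rightarrow> 'a \<Rightarrow> 'a" where
  "neg C f = inv\<^bsub>hom_group C (src C f) (tgt C f)\<^esub> f"

locale preadditive_category = category C for C :: "('o, 'a, 'm) addcat_scheme" (structure) +
  assumes hom_comm_group: "\<lbrakk>A \<in> Obj C; B \<in> Obj C\<rbrakk> \<Longrightarrow> comm_group (hom_group C A B)"
    and cmp_madd: "\<lbrakk>f \<in> Hom C A B; f' \<in> Hom C A B; g \<in> Hom C B D\<rbrakk>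
                     \<Longrightarrow> g \<cdot> (f \<boxplus> f') = (g \<cdot> f) \<boxplus> (g \<cdot> f')"
    and madd_cmp: "\<lbrakk>f \<in> Hom C A B; g \<in> Hom C B D; g' \<in> Hom C B D\<rbrakk>
                     \<Longrightarrow> (g \<boxplus> g') \<cdot> f = (g \<cdot> f) \<boxplus> (g' \<cdot> f)"

locale additive_category = preadditive_category C
  for C :: "('o, 'a, 'm) addcat_scheme" (structure) +
  assumes zobj_Obj: "zobj C \<in> Obj C"
    and zobj_initial: "A \<in> Obj C \<Longrightarrow> \<exists>!f. f \<in> Hom C (zobj C) A"
    and zobj_terminal: "A \<in> Obj C \<Longrightarrow> \<exists>!f. f \<in> Hom C A (zobj C)"
    and osum_Obj: "\<lbrakk>A \<in> Obj C; B \<in> Obj C\<rbrakk> \<Longrightarrow> A \<oplus> B \<in> Obj C"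
    and inl_Hom: "\<lbrakk>A \<in> Obj C; B \<in> Obj C\<rbrakk> \<Longrightarrow> inl C A B \<in> Hom C A (A \<oplus> B)"
    and inr_Hom: "\<lbrakk>A \<in> Obj C; B \<in> Obj C\<rbrakk> \<Longrightarrow> inr C A B \<in> Hom C B (A \<oplus> B)"
    and prl_Hom: "\<lbrakk>A \<in> Obj C; B \<in> Obj C\<rbrakk> \<Longrightarrow> prl C A B \<in> Hom C (A \<oplus> B) A"
    and prr_Hom: "\<lbrakk>A \<in> Obj C; B \<in> Obj C\<rbrakk> \<Longrightarrow> prr C A B \<in> Hom C (A \<oplus> B) B"
    and prl_inl: "\<lbrakk>A \<in> Obj C; B \<in> Obj C\<rbrakk> \<Longrightarrow> prl C A B \<cdot> inl C A B = ident C A"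
    and prr_inr: "\<lbrakk>A \<in> Obj C; B \<in> Obj C\<rbrakk> \<Longrightarrow> prr C A B \<cdot> inr C A B = ident C B"
    and prl_inr: "\<lbrakk>A \<in> Obj C; B \<in> Obj C\<rbrakk> \<Longrightarrow> prl C A B \<cdot> inr C A B = zarr C B A"
    and prr_inl: "\<lbrakk>A \<in> Obj C; B \<in> Obj C\<rbrakk> \<Longrightarrow> prr C A B \<cdot> inl C A B = zarr C A B"
    and inl_prl_inr_prr: "\<lbrakk>A \<in> Obj C; B \<in> Obj C\<rbrakk>
          \<Longrightarrow> (inl C A B \<cdot> prl C A B) \<boxplus> (inr C A B \<cdot> prr C A B) = ident C (A \<oplus> B)"

text \<open>Matrices act on column vectors; \<open>mat C a b c d\<close> has rows \<open>(a, b)\<close> and \<open>(c, d)\<close>.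
  The summands are read off from the sources and targets of the entries.\<close>

definition row :: "('o, 'a, 'm) addcat_scheme \<Rightarrow> 'a \<Rightarrow> 'a \<Rightarrow> 'a" where
  "row C a b = (a \<cdot>\<^bsub>C\<^esub> prl C (src C a) (src C b)) \<boxplus>\<^bsub>C\<^esub> (b \<cdot>\<^bsub>C\<^esub> prr C (src C a) (src C b))"

definition col :: "('o, 'a, 'm) addcat_scheme \<Rightarrow> 'a \<Rightarrow> 'a \<Rightarrow> 'a" where
  "col C a b = (inl C (tgt C a) (tgt C b) \<cdot>\<^bsub>C\<^esub> a) \<boxplus>\<^bsub>C\<^esub> (inr C (tgt C a) (tgt C b) \<cdot>\<^bsub>C\<^esub> b)"

definition mat :: "('o, 'a, 'm) addcat_scheme \<Rightarrow> 'a \<Rightarrow> 'a \<Rightarrow> 'a \<Rightarrow> 'a \<Rightarrow> 'a" where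
  "mat C a b c d = col C (row C a b) (row C c d)"


section \<open>Triangulated categories\<close>

text \<open>The self-equivalence \<open>\<Sigma>\<close> is given by \<open>shO\<close> on objects and \<open>sh\<close> on morphisms.
  A sequence \<open>X \<rightarrow> Y \<rightarrow> Z \<rightarrow> \<Sigma> X\<close> is represented by its three morphisms;
  \<open>Tri\<close> is the class of exact triangles.\<close>

record ('o, 'a) tricat = "('o, 'a) addcat" +
  shO :: "'o \<Rightarrow> 'o"
  sh :: "'a \<Rightarrow> 'a"
  Tri :: "('a \<times> 'a \<times> 'a) set"

definition candidates :: "('o, 'a, 'm) tricat_scheme \<Rightarrow> ('a \<times> 'a \<times> 'a) set" where
  "candidates T = {(u, v, w). u \<in> Arr T \<and> v \<in> Arr T \<and> w \<in> Arr T \<and>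
     tgt T u = src T v \<and> tgt T v = src T w \<and> tgt T w = shO T (src T u)}"

fun tri_map :: "('o, 'a, 'm) tricat_scheme \<Rightarrow> 'a \<times> 'a \<times> 'a \<Rightarrow> 'a \<times> 'a \<times> 'a
                 \<Rightarrow> 'a \<times> 'a \<times> 'a \<Rightarrow> bool" where
  "tri_map T (u, v, w) (u', v', w') (f, g, h) \<longleftrightarrow>
     f \<in> Hom T (src T u) (src T u') \<and> g \<in> Hom T (src T v) (src T v') \<and>
     h \<in> Hom T (src T w) (src T w') \<and>
     g \<cdot>\<^bsub>T\<^esub> u = u' \<cdot>\<^bsub>T\<^esub> f \<and> h \<cdot>\<^bsub>T\<^esub> v = v' \<cdot>\<^bsub>T\<^esub> g \<and> sh T f \<cdot>\<^bsub>T\<^esub> w = w' \<cdot>\<^bsub>T\<^esub> h"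

text \<open>The tuples are the exact triangles on \<open>a\<close>, \<open>b\<close> and \<open>b \<cdot> a\<close>, in this order.\<close>

fun octahedron :: "('o, 'a, 'm) tricat_scheme \<Rightarrow> 'a \<times> 'a \<times> 'a \<Rightarrow> 'a \<times> 'a \<times> 'a
                    \<Rightarrow> 'a \<times> 'a \<times> 'a \<Rightarrow> 'a \<times> 'a \<times> 'a \<Rightarrow> bool" where
  "octahedron T (a, a', a'') (b, b', b'') (ba, c', c'') (\<alpha>, \<beta>, \<gamma>) \<longleftrightarrow>
     \<alpha> \<in> Hom T (tgt T a') (tgt T c') \<and> \<beta> \<in> Hom T (tgt T c') (tgt T b') \<and>
     \<gamma> \<in> Hom T (tgt T b') (shO T (tgt T a')) \<and>
     (\<alpha>, \<beta>, \<gamma>) \<in> Tri T \<and>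
     \<alpha> \<cdot>\<^bsub>T\<^esub> a' = c' \<cdot>\<^bsub>T\<^esub> b \<and> c'' \<cdot>\<^bsub>T\<^esub> \<alpha> = a'' \<and> \<beta> \<cdot>\<^bsub>T\<^esub> c' = b' \<and>
     \<gamma> = sh T a' \<cdot>\<^bsub>T\<^esub> b'' \<and> b'' \<cdot>\<^bsub>T\<^esub> \<beta> = sh T a \<cdot>\<^bsub>T\<^esub> c''"

locale triangulated_category = additive_category T
  for T :: "('o, 'a, 'm) tricat_scheme" (structure) +
  assumes sh_equivalence: "is_equivalence T T (shO T) (sh T)"
    and sh_madd: "\<lbrakk>f \<in> Hom T A B; g \<in> Hom T A B\<rbrakk> \<Longrightarrow> sh T (f \<boxplus> g) = sh T f \<boxplus> sh T g"
    and Tri_candidates: "Tri T \<subseteq> candidates T"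
    and Tri_iso: "\<lbrakk>t \<in> Tri T; t' \<in> candidates T; tri_map T t t' (f, g, h);
                   is_iso T f; is_iso T g; is_iso T h\<rbrakk> \<Longrightarrow> t' \<in> Tri T"
    and Tri_ident: "A \<in> Obj T
          \<Longrightarrow> (ident T A, zarr T A (zobj T), zarr T (zobj T) (shO T A)) \<in> Tri T"
    and Tri_extend: "u \<in> Arr T \<Longrightarrow> \<exists>v w. (u, v, w) \<in> Tri T"
    and Tri_rotate: "(u, v, w) \<in> candidates T
          \<Longrightarrow> (u, v, w) \<in> Tri T \<longleftrightarrow> (v, w, neg T (sh T u)) \<in> Tri T"
    and Tri_fill: "\<lbrakk>(u, v, w) \<in> Tri T; (u', v', w') \<in> Tri T;
                    f \<in> Hom T (src T u) (src T u'); g \<in> Hom T (tgt T u) (tgt T u');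
                    g \<cdot> u = u' \<cdot> f\<rbrakk>
          \<Longrightarrow> \<exists>h. tri_map T (u, v, w) (u', v', w') (f, g, h)"
    and Tri_octahedral: "\<lbrakk>(a, a', a'') \<in> Tri T; (b, b', b'') \<in> Tri T; tgt T a = src T b;
                          (b \<cdot> a, c', c'') \<in> Tri T\<rbrakk>
          \<Longrightarrow> \<exists>\<alpha> \<beta> \<gamma>. octahedron T (a, a', a'') (b, b', b'') (b \<cdot> a, c', c'') (\<alpha>, \<beta>, \<gamma>)"

text \<open>The canonical isomorphism \<open>\<Sigma> A \<oplus> \<Sigma> B \<rightarrow> \<Sigma> (A \<oplus> B)\<close>, which is left implicit in
  informal notation: whenever the last term of a triangle is written \<open>\<Sigma> A \<oplus> \<Sigma> B\<close> while the
  first one is \<open>A \<oplus> B\<close>, the last map has to be followed by it.\<close>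

definition shsum :: "('o, 'a, 'm) tricat_scheme \<Rightarrow> 'o \<Rightarrow> 'o \<Rightarrow> 'a" where
  "shsum T A B = row T (sh T (inl T A B)) (sh T (inr T A B))"


section \<open>Good and Verdier good maps of triangles\<close>

fun mapping_cone :: "('o, 'a, 'm) tricat_scheme \<Rightarrow> 'a \<times> 'a \<times> 'a \<Rightarrow> 'a \<times> 'a \<times> 'a
                      \<Rightarrow> 'a \<times> 'a \<times> 'a \<Rightarrow> 'a \<times> 'a \<times> 'a" where
  "mapping_cone T (u, v, w) (u', v', w') (f, g, h) =
     (mat T u' g (zarr T (src T u') (tgt T v)) (neg T v),
      mat T v' h (zarr T (src T v') (tgt T w)) (neg T w),
      shsum T (src T u') (tgt T u) \<cdot>\<^bsub>T\<^esub>
        mat T w' (sh T f) (zarr T (src T w') (shO T (tgt T u))) (neg T (sh T u)))"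

definition good :: "('o, 'a, 'm) tricat_scheme \<Rightarrow> 'a \<times> 'a \<times> 'a \<Rightarrow> 'a \<times> 'a \<times> 'a
                      \<Rightarrow> 'a \<times> 'a \<times> 'a \<Rightarrow> bool" where
  "good T t t' m \<longleftrightarrow> mapping_cone T t t' m \<in> Tri T"

text \<open>The exact triangles on \<open>f\<close>, \<open>g\<close> and \<open>g \<cdot> u\<close> are auxiliary choices on which the notion
  does not depend; here they are quantified existentially.\<close>

fun verdier_good :: "('o, 'a, 'm) tricat_scheme \<Rightarrow> 'a \<times> 'a \<times> 'a \<Rightarrow> 'a \<times> 'a \<times> 'a
                      \<Rightarrow> 'a \<times> 'a \<times> 'a \<Rightarrow> bool" where
  "verdier_good T (u, v, w) (u', v', w') (f, g, h) \<longleftrightarrow>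
     (\<exists>f' f'' g' g'' v\<^sub>A w\<^sub>A.
        (f, f', f'') \<in> Tri T \<and> (g, g', g'') \<in> Tri T \<and> (g \<cdot>\<^bsub>T\<^esub> u, v\<^sub>A, w\<^sub>A) \<in> Tri T \<and>
        (\<exists>\<alpha>\<^sub>1 \<beta>\<^sub>1 \<gamma>\<^sub>1 \<alpha>\<^sub>2 \<beta>\<^sub>2 \<gamma>\<^sub>2.
           octahedron T (u, v, w) (g, g', g'') (g \<cdot>\<^bsub>T\<^esub> u, v\<^sub>A, w\<^sub>A) (\<alpha>\<^sub>1, \<beta>\<^sub>1, \<gamma>\<^sub>1) \<and>
           octahedron T (f, f', f'') (u', v', w') (u' \<cdot>\<^bsub>T\<^esub> f, v\<^sub>A, w\<^sub>A) (\<alpha>\<^sub>2, \<beta>\<^sub>2, \<gamma>\<^sub>2) \<and>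
           h = \<beta>\<^sub>2 \<cdot>\<^bsub>T\<^esub> \<alpha>\<^sub>1))"

end

theory Submission
  imports Defs
begin

text \<open>
  Write a mapping cone as a block matrix. Since the map of triangles has identity blocks,
  elementary row and column operations split off a contractible triangle of the form
  \<open>A \<oplus> B \<rightarrow> B \<rightarrow> \<Sigma> A \<rightarrow> \<Sigma> (A \<oplus> B)\<close>, and what remains is the triangle of condition (c)
  (in part (2): its rotation). Sums and retracts of exact triangles are exact by the five lemma,
  so the cone is exact iff condition (c) holds.

  For Verdier goodness, the split triangles on the inclusions (projections) identify the cone
  \<open>A\<close> of the diagonal composite with \<open>Z \<oplus> Y''\<close> (with \<open>\<Sigma> X \<oplus> Z''\<close>); under this identification
  one of the two octahedra becomes split, and the exact triangle of the other one becomes (c).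

  When \<open>c = 0\<close>, the matrix is a direct sum, and \<open>h\<close> together with any fill-in for the
  complementary summand identifies \<open>Z'\<close> with \<open>Z \<oplus> Z''\<close>; this turns the triangle of (c), up to
  rotation in part (2), into the sum of an exact triangle and a contractible one.
\<close>

section \<open>Matrix calculus in additive categories\<close>

text \<open>Cones are unique only up to non-canonical isomorphism, so neither a summand of a
  triangle nor the cone \<open>A\<close> in arbitrary octahedra can be identified formally. Each
  identification is a map of triangles over two isomorphisms, to which the five lemma is applied.
  That lemma needs only exactness of the sequences Hom(W, -), which summands inherit before they are
  known to be exact. Goodness and Verdier goodness are never compared directly: condition (c) is the
  middle term because it involves no choices. Starting from arbitrary octahedra, the comparison maps
  have to be constructed; in the other direction split triangles can be chosen, and the triangle of
  (c) itself supplies the maps of one octahedron. Since \<Sigma> is only an equivalence, \<Sigma>(A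
  \<oplus> B) and \<Sigma>A \<oplus> \<Sigma>B are different objects and lifts must be desuspended
  by fullness. In part (2) the remaining summand of the cone starts at Y rather than at a shift; it
  is an inverse rotation of the triangle of (c), with a sign on \<open>v\<^sub>1'\<close>.\<close>

context category
begin

lemma Hom_iff: "f \<in> Hom C A B \<longleftrightarrow> f \<in> Arr C \<and> src C f = A \<and> tgt C f = B"
  by (auto simp: Hom_def)

lemma src_in_Obj [simp]: "f \<in> Arr C \<Longrightarrow> src C f \<in> Obj C"
  and tgt_in_Obj [simp]: "f \<in> Arr C \<Longrightarrow> tgt C f \<in> Obj C"
  by (simp_all add: src_Obj tgt_Obj)

lemma ident_simps [simp]:
  assumes "A \<in> Obj C"
  shows "ident C A \<in> Arr C" "src C (ident C A) = A" "tgt C (ident C A) = A"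
  using ident_Hom [OF assms] by (auto simp: Hom_iff)

lemma cmp_simps [simp]:
  assumes "f \<in> Arr C" "g \<in> Arr C" "tgt C f = src C g"
  shows "g \<cdot> f \<in> Arr C" "src C (g \<cdot> f) = src C f" "tgt C (g \<cdot> f) = tgt C g"
  using cmp_Hom [of f "src C f" "src C g" g "tgt C g"] assms by (auto simp: Hom_iff)

lemma cmp_ident_right [simp]: "\<lbrakk>f \<in> Arr C; src C f = A\<rbrakk> \<Longrightarrow> f \<cdot> ident C A = f"
  and cmp_ident_left [simp]: "\<lbrakk>f \<in> Arr C; tgt C f = A\<rbrakk> \<Longrightarrow> ident C A \<cdot> f = f"
  using cmp_ident ident_cmp by (auto simp: Hom_iff)

lemma cmp_assoc_simp [simp]:
  "\<lbrakk>f \<in> Arr C; g \<in> Arr C; h \<in> Arr C; tgt C f = src C g; tgt C g = src C h\<rbrakk>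
    \<Longrightarrow> (h \<cdot> g) \<cdot> f = h \<cdot> (g \<cdot> f)"
  using cmp_assoc by (auto simp: Hom_iff)

text \<open>With composites bracketed to the right, an equation for \<open>g \<cdot> f\<close> has
  to be applied in front of a further factor; the relations between maps of triangles are used in
  this form.\<close>

lemma cmp_reassoc:
  "\<lbrakk>g \<cdot> f = k; f \<in> Arr C; g \<in> Arr C; tgt C f = src C g; x \<in> Arr C; tgt C x = src C f\<rbrakk>
    \<Longrightarrow> g \<cdot> (f \<cdot> x) = k \<cdot> x"
  by (auto simp flip: cmp_assoc_simp)

lemma is_isoI:
  assumes "f \<in> Arr C" "g \<in> Arr C" "src C g = tgt C f" "tgt C g = src C f"
    "g \<cdot> f = ident C (src C f)" "f \<cdot> g = ident C (tgt C f)"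
  shows "is_iso C f"
  using assms by (auto simp: is_iso_def Hom_iff)

lemma is_isoE:
  assumes "is_iso C f"
  obtains g where "f \<in> Arr C" "g \<in> Arr C" "src C g = tgt C f" "tgt C g = src C f"
    "g \<cdot> f = ident C (src C f)" "f \<cdot> g = ident C (tgt C f)" "is_iso C g"
proof -
  obtain g where g: "f \<in> Arr C" "g \<in> Arr C" "src C g = tgt C f" "tgt C g = src C f"
    "g \<cdot> f = ident C (src C f)" "f \<cdot> g = ident C (tgt C f)"
    using assms by (auto simp: is_iso_def Hom_iff)
  moreover have "is_iso C g"
    using g by (intro is_isoI [of g f]) auto
  ultimately show thesis
    using that by blast
qed

lemma is_iso_ident [simp]: "A \<in> Obj C \<Longrightarrow> is_iso C (ident C A)"
  by (rule is_isoI [of _ "ident C A"]) auto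

lemma iso_cancel_left:
  assumes "is_iso C e" "f \<in> Arr C" "g \<in> Arr C" "tgt C f = src C e" "tgt C g = src C e" "e \<cdot> f = e \<cdot> g"
  shows "f = g"
proof -
  obtain i where i: "e \<in> Arr C" "i \<in> Arr C" "src C i = tgt C e" "tgt C i = src C e"
    "i \<cdot> e = ident C (src C e)"
    using assms(1) by (rule is_isoE)
  have "(i \<cdot> e) \<cdot> f = (i \<cdot> e) \<cdot> g"
    using assms i(1-4) by simp
  then show ?thesis
    using assms i by simp
qed

lemma iso_cancel_right:
  assumes "is_iso C e" "f \<in> Arr C" "g \<in> Arr C" "src C f = tgt C e" "src C g = tgt C e" "f \<cdot> e = g \<cdot> e"
  shows "f = g"
proof -
  obtain i where i: "e \<in> Arr C" "i \<in> Arr C" "src C i = tgt C e" "tgt C i = src C e"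
    "e \<cdot> i = ident C (tgt C e)"
    using assms(1) by (rule is_isoE)
  have "(f \<cdot> e) \<cdot> i = (g \<cdot> e) \<cdot> i"
    using assms(6) by simp
  then show ?thesis
    using assms(1-5) i by simp
qed

text \<open>Inserting \<open>f \<cdot> f'\<close> behind \<open>u'\<close> and cancelling
  \<open>g' \<cdot> g\<close> inverts the square. Hence the inverses of the components of an
  isomorphism of triangles form a map of triangles.\<close>

lemma iso_square_inverse:
  assumes "g \<cdot> u = u' \<cdot> f"
    "f \<in> Arr C" "f' \<in> Arr C" "src C f' = tgt C f" "tgt C f' = src C f" "f \<cdot> f' = ident C (tgt C f)"
    "g \<in> Arr C" "g' \<in> Arr C" "src C g' = tgt C g" "tgt C g' = src C g" "g' \<cdot> g = ident C (src C g)"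
    "u \<in> Arr C" "u' \<in> Arr C" "src C u = src C f" "tgt C u = src C g"
    "src C u' = tgt C f" "tgt C u' = tgt C g"
  shows "g' \<cdot> u' = u \<cdot> f'"
proof -
  have "g' \<cdot> u' = g' \<cdot> (u' \<cdot> (f \<cdot> f'))"
    using assms by simp
  also have "\<dots> = g' \<cdot> (g \<cdot> (u \<cdot> f'))"
    using assms(2-) by (simp add: cmp_reassoc [OF assms(1)])
  also have "\<dots> = u \<cdot> f'"
    using assms(2-) by (subst cmp_reassoc [OF assms(11)]) simp_all
  finally show ?thesis .
qed

lemma is_iso_cmp:
  assumes "is_iso C f" "is_iso C g" "tgt C f = src C g"
  shows "is_iso C (g \<cdot> f)"
proof -
  obtain f' where f': "f \<in> Arr C" "f' \<in> Arr C" "src C f' = tgt C f" "tgt C f' = src C f"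
    "f' \<cdot> f = ident C (src C f)" "f \<cdot> f' = ident C (tgt C f)"
    using assms(1) by (rule is_isoE)
  obtain g' where g': "g \<in> Arr C" "g' \<in> Arr C" "src C g' = tgt C g" "tgt C g' = src C g"
    "g' \<cdot> g = ident C (src C g)" "g \<cdot> g' = ident C (tgt C g)"
    using assms(2) by (rule is_isoE)
  show ?thesis
    using assms(3) f' g' cmp_reassoc [OF f'(6)] cmp_reassoc [OF g'(5)]
    by (intro is_isoI [of "g \<cdot> f" "f' \<cdot> g'"]) simp_all
qed

end

context preadditive_category
begin

lemma hom_group_simps:
  "carrier (hom_group C A B) = Hom C A B" "monoid.mult (hom_group C A B) = madd C"
  "one (hom_group C A B) = zarr C A B"
  by (simp_all add: hom_group_def)

lemma zarr_simps [simp]: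
  assumes "A \<in> Obj C" "B \<in> Obj C"
  shows "zarr C A B \<in> Arr C" "src C (zarr C A B) = A" "tgt C (zarr C A B) = B"
proof -
  interpret G: comm_group "hom_group C A B"
    using hom_comm_group assms .
  show "zarr C A B \<in> Arr C" "src C (zarr C A B) = A" "tgt C (zarr C A B) = B"
    using G.one_closed by (auto simp: hom_group_simps Hom_iff)
qed

lemma madd_simps [simp]:
  assumes "f \<in> Arr C" "g \<in> Arr C" "src C f = src C g" "tgt C f = tgt C g"
  shows "f \<boxplus> g \<in> Arr C" "src C (f \<boxplus> g) = src C g" "tgt C (f \<boxplus> g) = tgt C g"
proof -
  interpret G: comm_group "hom_group C (src C f) (tgt C f)"
    using assms by (auto intro!: hom_comm_group)
  have "f \<boxplus> g \<in> Hom C (src C f) (tgt C f)"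
    using G.m_closed [of f g] assms by (auto simp: hom_group_simps Hom_iff)
  then show "f \<boxplus> g \<in> Arr C" "src C (f \<boxplus> g) = src C g" "tgt C (f \<boxplus> g) = tgt C g"
    using assms by (auto simp: Hom_iff)
qed

lemma neg_simps [simp]:
  assumes "f \<in> Arr C"
  shows "neg C f \<in> Arr C" "src C (neg C f) = src C f" "tgt C (neg C f) = tgt C f"
proof -
  interpret G: comm_group "hom_group C (src C f) (tgt C f)"
    using assms by (auto intro!: hom_comm_group)
  have "neg C f \<in> Hom C (src C f) (tgt C f)"
    using G.inv_closed [of f] assms by (auto simp: hom_group_simps Hom_iff neg_def)
  then show "neg C f \<in> Arr C" "src C (neg C f) = src C f" "tgt C (neg C f) = tgt C f"
    by (auto simp: Hom_iff)
qed

lemma madd_assoc [simp]: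
  assumes "f \<in> Arr C" "g \<in> Arr C" "h \<in> Arr C" "src C f = src C g" "tgt C f = tgt C g"
    "src C g = src C h" "tgt C g = tgt C h"
  shows "(f \<boxplus> g) \<boxplus> h = f \<boxplus> (g \<boxplus> h)"
proof -
  interpret G: comm_group "hom_group C (src C f) (tgt C f)"
    using assms by (auto intro!: hom_comm_group)
  show ?thesis
    using G.m_assoc [of f g h] assms by (auto simp: hom_group_simps Hom_iff)
qed

lemma madd_comm:
  assumes "f \<in> Arr C" "g \<in> Arr C" "src C f = src C g" "tgt C f = tgt C g"
  shows "f \<boxplus> g = g \<boxplus> f"
proof -
  interpret G: comm_group "hom_group C (src C f) (tgt C f)"
    using assms by (auto intro!: hom_comm_group)
  show ?thesis
    using G.m_comm [of f g] assms by (auto simp: hom_group_simps Hom_iff)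
qed

lemma madd_left_comm:
  assumes "f \<in> Arr C" "g \<in> Arr C" "h \<in> Arr C" "src C f = src C g" "tgt C f = tgt C g"
    "src C g = src C h" "tgt C g = tgt C h"
  shows "f \<boxplus> (g \<boxplus> h) = g \<boxplus> (f \<boxplus> h)"
  using assms madd_comm [of f g] by (simp flip: madd_assoc)

lemma madd_zarr_left [simp]:
  assumes "f \<in> Arr C" "src C f = A" "tgt C f = B"
  shows "zarr C A B \<boxplus> f = f"
proof -
  interpret G: comm_group "hom_group C (src C f) (tgt C f)"
    using assms by (auto intro!: hom_comm_group)
  show ?thesis
    using G.l_one [of f] assms by (auto simp: hom_group_simps Hom_iff)
qed

lemma madd_zarr_right [simp]:
  "\<lbrakk>f \<in> Arr C; src C f = A; tgt C f = B\<rbrakk> \<Longrightarrow> f \<boxplus> zarr C A B = f"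
  by (metis madd_comm madd_zarr_left src_in_Obj tgt_in_Obj zarr_simps)

lemma madd_neg [simp]:
  assumes "f \<in> Arr C"
  shows "neg C f \<boxplus> f = zarr C (src C f) (tgt C f)" "f \<boxplus> neg C f = zarr C (src C f) (tgt C f)"
proof -
  interpret G: comm_group "hom_group C (src C f) (tgt C f)"
    using assms by (auto intro!: hom_comm_group)
  show "neg C f \<boxplus> f = zarr C (src C f) (tgt C f)"
    using G.l_inv [of f] assms by (auto simp: hom_group_simps Hom_iff neg_def)
  then show "f \<boxplus> neg C f = zarr C (src C f) (tgt C f)"
    using assms by (simp add: madd_comm [of f])
qed

lemma madd_neg_cancel [simp]:
  assumes "f \<in> Arr C" "g \<in> Arr C" "src C f = src C g" "tgt C f = tgt C g"
  shows "neg C f \<boxplus> (f \<boxplus> g) = g" "f \<boxplus> (neg C f \<boxplus> g) = g"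
  using assms by (simp_all flip: madd_assoc)

lemma neg_unique:
  assumes "f \<in> Arr C" "g \<in> Arr C" "src C f = src C g" "tgt C f = tgt C g"
    "f \<boxplus> g = zarr C (src C g) (tgt C g)"
  shows "g = neg C f"
  using madd_neg_cancel(1) [of f g] assms by simp

lemma neg_neg [simp]: "f \<in> Arr C \<Longrightarrow> neg C (neg C f) = f"
  by (rule neg_unique [symmetric]) simp_all

lemma neg_madd [simp]:
  assumes "f \<in> Arr C" "g \<in> Arr C" "src C f = src C g" "tgt C f = tgt C g"
  shows "neg C (f \<boxplus> g) = neg C f \<boxplus> neg C g"
  using assms by (intro neg_unique [symmetric]) (simp_all add: madd_left_comm [of g])

lemma neg_zarr [simp]: "\<lbrakk>A \<in> Obj C; B \<in> Obj C\<rbrakk> \<Longrightarrow> neg C (zarr C A B) = zarr C A B"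
  by (rule neg_unique [symmetric]) simp_all

lemma cmp_madd_simp [simp]:
  "\<lbrakk>f \<in> Arr C; f' \<in> Arr C; g \<in> Arr C; src C f = src C f'; tgt C f = tgt C f'; tgt C f' = src C g\<rbrakk>
    \<Longrightarrow> g \<cdot> (f \<boxplus> f') = (g \<cdot> f) \<boxplus> (g \<cdot> f')"
  by (rule cmp_madd) (auto simp: Hom_iff)

lemma madd_cmp_simp [simp]:
  "\<lbrakk>f \<in> Arr C; g \<in> Arr C; g' \<in> Arr C; src C g = src C g'; tgt C g = tgt C g'; tgt C f = src C g'\<rbrakk>
    \<Longrightarrow> (g \<boxplus> g') \<cdot> f = (g \<cdot> f) \<boxplus> (g' \<cdot> f)"
  by (rule madd_cmp) (auto simp: Hom_iff)

text \<open>Cancellation in the Hom group. It turns additivity into preservation of zero, both for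
  composition with a fixed map and for \<Sigma>.\<close>

lemma madd_idem_imp_zarr:
  assumes "f \<in> Arr C" "f \<boxplus> f = f"
  shows "f = zarr C (src C f) (tgt C f)"
  using madd_neg_cancel(1) [of f f] assms by simp

lemma cmp_zarr [simp]:
  assumes "f \<in> Arr C" "src C f = B" "A \<in> Obj C"
  shows "f \<cdot> zarr C A B = zarr C A (tgt C f)"
proof -
  have "f \<cdot> (zarr C A B \<boxplus> zarr C A B) = f \<cdot> zarr C A B"
    using assms by (subst madd_zarr_left) auto
  then have "(f \<cdot> zarr C A B) \<boxplus> (f \<cdot> zarr C A B) = f \<cdot> zarr C A B"
    using assms by (subst (asm) cmp_madd_simp) auto
  then show ?thesis
    using madd_idem_imp_zarr [of "f \<cdot> zarr C A B"] assms by auto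
qed

lemma zarr_cmp [simp]:
  assumes "f \<in> Arr C" "tgt C f = A" "B \<in> Obj C"
  shows "zarr C A B \<cdot> f = zarr C (src C f) B"
proof -
  have "(zarr C A B \<boxplus> zarr C A B) \<cdot> f = zarr C A B \<cdot> f"
    using assms by (subst madd_zarr_left) auto
  then have "(zarr C A B \<cdot> f) \<boxplus> (zarr C A B \<cdot> f) = zarr C A B \<cdot> f"
    using assms by (subst (asm) madd_cmp_simp) auto
  then show ?thesis
    using madd_idem_imp_zarr [of "zarr C A B \<cdot> f"] assms by auto
qed

lemma cmp_neg [simp]:
  assumes "f \<in> Arr C" "g \<in> Arr C" "tgt C f = src C g"
  shows "g \<cdot> neg C f = neg C (g \<cdot> f)"
  using assms by (intro neg_unique) (simp_all flip: cmp_madd_simp)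

lemma neg_cmp [simp]:
  assumes "f \<in> Arr C" "g \<in> Arr C" "tgt C f = src C g"
  shows "neg C g \<cdot> f = neg C (g \<cdot> f)"
  using assms by (intro neg_unique) (simp_all flip: madd_cmp_simp)

lemma neg_eq_iff [simp]: "\<lbrakk>f \<in> Arr C; g \<in> Arr C\<rbrakk> \<Longrightarrow> neg C f = neg C g \<longleftrightarrow> f = g"
  by (metis neg_neg)

lemma neg_eq_zarr_iff [simp]:
  "\<lbrakk>f \<in> Arr C; A \<in> Obj C; B \<in> Obj C\<rbrakk> \<Longrightarrow> neg C f = zarr C A B \<longleftrightarrow> f = zarr C A B"
  by (metis neg_neg neg_zarr)

lemma madd_neg_eq_zarrD:
  assumes "f \<boxplus> neg C g = zarr C A B" "f \<in> Arr C" "g \<in> Arr C" "src C f = src C g" "tgt C f = tgt C g"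
    "src C g = A" "tgt C g = B"
  shows "f = g"
proof -
  have "neg C g = neg C f"
    using assms by (intro neg_unique) auto
  then show ?thesis
    using assms(2,3) by simp
qed

lemma is_iso_neg_ident [simp]: "A \<in> Obj C \<Longrightarrow> is_iso C (neg C (ident C A))"
  by (rule is_isoI [of _ "neg C (ident C A)"]) simp_all

end

context additive_category
begin

lemma zobj_Obj_simp [simp]: "zobj C \<in> Obj C"
  by (rule zobj_Obj)

lemma zarr_from_zobj: "\<lbrakk>f \<in> Arr C; src C f = zobj C\<rbrakk> \<Longrightarrow> f = zarr C (zobj C) (tgt C f)"
  using zobj_initial [of "tgt C f"] by (auto simp: Hom_iff)

lemma ident_zobj [simp]: "ident C (zobj C) = zarr C (zobj C) (zobj C)"
  by (metis ident_simps zarr_from_zobj zobj_Obj)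

lemma osum_simps [simp]:
  assumes "A \<in> Obj C" "B \<in> Obj C"
  shows "A \<oplus> B \<in> Obj C"
    "inl C A B \<in> Arr C" "src C (inl C A B) = A" "tgt C (inl C A B) = A \<oplus> B"
    "inr C A B \<in> Arr C" "src C (inr C A B) = B" "tgt C (inr C A B) = A \<oplus> B"
    "prl C A B \<in> Arr C" "src C (prl C A B) = A \<oplus> B" "tgt C (prl C A B) = A"
    "prr C A B \<in> Arr C" "src C (prr C A B) = A \<oplus> B" "tgt C (prr C A B) = B"
  using assms osum_Obj inl_Hom [OF assms] inr_Hom [OF assms] prl_Hom [OF assms] prr_Hom [OF assms]
  by (auto simp: Hom_iff)

lemmas biproduct_eqs = prl_inl prr_inr prl_inr prr_inl

lemma biproduct_cmp_eqs:
  assumes "A \<in> Obj C" "B \<in> Obj C" "f \<in> Arr C"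
  shows "tgt C f = A \<Longrightarrow> prl C A B \<cdot> (inl C A B \<cdot> f) = f"
    "tgt C f = B \<Longrightarrow> prr C A B \<cdot> (inr C A B \<cdot> f) = f"
    "tgt C f = B \<Longrightarrow> prl C A B \<cdot> (inr C A B \<cdot> f) = zarr C (src C f) A"
    "tgt C f = A \<Longrightarrow> prr C A B \<cdot> (inl C A B \<cdot> f) = zarr C (src C f) B"
  using assms by (simp_all add: biproduct_eqs flip: cmp_assoc_simp)

lemma row_simps [simp]:
  assumes "a \<in> Arr C" "b \<in> Arr C" "tgt C a = tgt C b"
  shows "row C a b \<in> Arr C" "src C (row C a b) = src C a \<oplus> src C b" "tgt C (row C a b) = tgt C b"
  using assms by (auto simp: row_def)

lemma col_simps [simp]:
  assumes "a \<in> Arr C" "b \<in> Arr C" "src C a = src C b"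
  shows "col C a b \<in> Arr C" "src C (col C a b) = src C b" "tgt C (col C a b) = tgt C a \<oplus> tgt C b"
  using assms by (auto simp: col_def)

lemma row_col [simp]:
  assumes "a \<in> Arr C" "b \<in> Arr C" "tgt C a = tgt C b" "c \<in> Arr C" "d \<in> Arr C" "src C c = src C d"
    "tgt C c = src C a" "tgt C d = src C b"
  shows "row C a b \<cdot> col C c d = (a \<cdot> c) \<boxplus> (b \<cdot> d)"
  using assms by (simp add: row_def col_def biproduct_cmp_eqs)

lemma cmp_row [simp]:
  assumes "a \<in> Arr C" "b \<in> Arr C" "tgt C a = tgt C b" "f \<in> Arr C" "src C f = tgt C b"
  shows "f \<cdot> row C a b = row C (f \<cdot> a) (f \<cdot> b)"
  using assms by (simp add: row_def)

lemma col_cmp [simp]: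
  assumes "a \<in> Arr C" "b \<in> Arr C" "src C a = src C b" "f \<in> Arr C" "tgt C f = src C b"
  shows "col C a b \<cdot> f = col C (a \<cdot> f) (b \<cdot> f)"
  using assms by (simp add: col_def)

lemma mat_simps [simp]:
  assumes "a \<in> Arr C" "b \<in> Arr C" "c \<in> Arr C" "d \<in> Arr C"
    "src C a = src C c" "src C b = src C d" "tgt C a = tgt C b" "tgt C c = tgt C d"
  shows "mat C a b c d \<in> Arr C" "src C (mat C a b c d) = src C c \<oplus> src C d"
    "tgt C (mat C a b c d) = tgt C b \<oplus> tgt C d"
  using assms by (auto simp: mat_def)

lemma madd_swap:
  assumes "a \<in> Arr C" "b \<in> Arr C" "c \<in> Arr C" "d \<in> Arr C"
    "src C a = src C d" "src C b = src C d" "src C c = src C d"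
    "tgt C a = tgt C d" "tgt C b = tgt C d" "tgt C c = tgt C d"
  shows "a \<boxplus> (b \<boxplus> (c \<boxplus> d)) = a \<boxplus> (c \<boxplus> (b \<boxplus> d))"
  using assms by (simp add: madd_left_comm [of b c])

text \<open>Both sides are the sum of the same four terms, with the middle two exchanged. Columns of
  rows thus become the normal form of block matrices.\<close>

lemma row_col_swap [simp]:
  assumes "a \<in> Arr C" "b \<in> Arr C" "c \<in> Arr C" "d \<in> Arr C"
    "src C a = src C b" "src C c = src C d" "tgt C a = tgt C c" "tgt C b = tgt C d"
  shows "row C (col C a b) (col C c d) = col C (row C a c) (row C b d)"
  using assms by (simp add: row_def col_def madd_swap)

lemma row_madd [simp]:
  assumes "a \<in> Arr C" "b \<in> Arr C" "c \<in> Arr C" "d \<in> Arr C"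
    "src C a = src C c" "src C b = src C d" "tgt C a = tgt C b" "tgt C b = tgt C d" "tgt C c = tgt C d"
  shows "row C a b \<boxplus> row C c d = row C (a \<boxplus> c) (b \<boxplus> d)"
  using assms by (simp add: row_def madd_swap)

lemma col_madd [simp]:
  assumes "a \<in> Arr C" "b \<in> Arr C" "c \<in> Arr C" "d \<in> Arr C"
    "tgt C a = tgt C c" "tgt C b = tgt C d" "src C a = src C b" "src C b = src C d" "src C c = src C d"
  shows "col C a b \<boxplus> col C c d = col C (a \<boxplus> c) (b \<boxplus> d)"
  using assms by (simp add: col_def madd_swap)

lemma row_neg [simp]:
  "\<lbrakk>a \<in> Arr C; b \<in> Arr C; tgt C a = tgt C b\<rbrakk> \<Longrightarrow> neg C (row C a b) = row C (neg C a) (neg C b)"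
  by (simp add: row_def)

lemma col_neg [simp]:
  "\<lbrakk>a \<in> Arr C; b \<in> Arr C; src C a = src C b\<rbrakk> \<Longrightarrow> neg C (col C a b) = col C (neg C a) (neg C b)"
  by (simp add: col_def)

lemma row_zarr:
  "\<lbrakk>A \<in> Obj C; B \<in> Obj C; D \<in> Obj C\<rbrakk> \<Longrightarrow> zarr C (A \<oplus> B) D = row C (zarr C A D) (zarr C B D)"
  by (simp add: row_def)

lemma col_zarr:
  "\<lbrakk>A \<in> Obj C; B \<in> Obj C; D \<in> Obj C\<rbrakk> \<Longrightarrow> zarr C D (A \<oplus> B) = col C (zarr C D A) (zarr C D B)"
  by (simp add: col_def)

lemma inl_eq_col: "\<lbrakk>A \<in> Obj C; B \<in> Obj C\<rbrakk> \<Longrightarrow> inl C A B = col C (ident C A) (zarr C A B)"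
  and inr_eq_col: "\<lbrakk>A \<in> Obj C; B \<in> Obj C\<rbrakk> \<Longrightarrow> inr C A B = col C (zarr C B A) (ident C B)"
  by (simp_all add: col_def)

lemma prl_eq_row: "\<lbrakk>A \<in> Obj C; B \<in> Obj C\<rbrakk> \<Longrightarrow> prl C A B = row C (ident C A) (zarr C B A)"
  and prr_eq_row: "\<lbrakk>A \<in> Obj C; B \<in> Obj C\<rbrakk> \<Longrightarrow> prr C A B = row C (zarr C A B) (ident C B)"
  by (simp_all add: row_def)

lemma ident_osum:
  "\<lbrakk>A \<in> Obj C; B \<in> Obj C\<rbrakk> \<Longrightarrow> ident C (A \<oplus> B)
     = col C (row C (ident C A) (zarr C B A)) (row C (zarr C A B) (ident C B))"
  using inl_prl_inr_prr [of A B] by (simp add: prl_eq_row [symmetric] prr_eq_row [symmetric] col_def)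

lemma prl_col: "\<lbrakk>a \<in> Arr C; b \<in> Arr C; src C a = src C b; tgt C a = A; tgt C b = B\<rbrakk>
    \<Longrightarrow> prl C A B \<cdot> col C a b = a"
  and prr_col: "\<lbrakk>a \<in> Arr C; b \<in> Arr C; src C a = src C b; tgt C a = A; tgt C b = B\<rbrakk>
    \<Longrightarrow> prr C A B \<cdot> col C a b = b"
  by (auto simp: prl_eq_row prr_eq_row)

lemma row_inl: "\<lbrakk>a \<in> Arr C; b \<in> Arr C; tgt C a = tgt C b; src C a = A; src C b = B\<rbrakk>
    \<Longrightarrow> row C a b \<cdot> inl C A B = a"
  and row_inr: "\<lbrakk>a \<in> Arr C; b \<in> Arr C; tgt C a = tgt C b; src C a = A; src C b = B\<rbrakk>
    \<Longrightarrow> row C a b \<cdot> inr C A B = b"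
  by (auto simp: inl_eq_col inr_eq_col)

lemma col_eta:
  assumes "f \<in> Arr C" "tgt C f = A \<oplus> B" "A \<in> Obj C" "B \<in> Obj C"
  shows "col C (prl C A B \<cdot> f) (prr C A B \<cdot> f) = f"
  using assms inl_prl_inr_prr [of A B, symmetric] cmp_ident_left [of f "A \<oplus> B"]
  by (simp add: col_def del: cmp_ident_left)

lemma row_eta:
  assumes "f \<in> Arr C" "src C f = A \<oplus> B" "A \<in> Obj C" "B \<in> Obj C"
  shows "row C (f \<cdot> inl C A B) (f \<cdot> inr C A B) = f"
  using assms inl_prl_inr_prr [of A B, symmetric] cmp_ident_right [of f "A \<oplus> B"]
  by (simp add: row_def del: cmp_ident_right)

lemma col_eq_iff [simp]:
  assumes "a \<in> Arr C" "b \<in> Arr C" "c \<in> Arr C" "d \<in> Arr C"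
    "tgt C a = tgt C c" "tgt C b = tgt C d" "src C a = src C b" "src C c = src C d"
  shows "col C a b = col C c d \<longleftrightarrow> a = c \<and> b = d"
  using assms prl_col prr_col by metis

lemma row_eq_iff [simp]:
  assumes "a \<in> Arr C" "b \<in> Arr C" "c \<in> Arr C" "d \<in> Arr C"
    "src C a = src C c" "src C b = src C d" "tgt C a = tgt C b" "tgt C c = tgt C d"
  shows "row C a b = row C c d \<longleftrightarrow> a = c \<and> b = d"
  using assms row_inl row_inr by metis

text \<open>Once all structure maps of a sum are matrices, an identity between block maps splits
  into identities between entries by \<open>row_eq_iff\<close> and
  \<open>col_eq_iff\<close>.\<close>

lemmas matrix_simps = mat_def row_zarr col_zarr inl_eq_col inr_eq_col prl_eq_row prr_eq_row
  ident_osum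

lemma is_iso_zobj [simp]: "is_iso C (zarr C (zobj C) (zobj C))"
  using is_iso_ident [of "zobj C"] by simp

definition diag :: "'a \<Rightarrow> 'a \<Rightarrow> 'a" where
  "diag a b = mat C a (zarr C (src C b) (tgt C a)) (zarr C (src C a) (tgt C b)) b"

lemma diag_simps [simp]:
  assumes "a \<in> Arr C" "b \<in> Arr C"
  shows "diag a b \<in> Arr C" "src C (diag a b) = src C a \<oplus> src C b" "tgt C (diag a b) = tgt C a \<oplus> tgt C b"
  using assms by (auto simp: diag_def mat_def)

lemma diag_col:
  assumes "a \<in> Arr C" "b \<in> Arr C" "c \<in> Arr C" "d \<in> Arr C" "src C c = src C d"
    "tgt C c = src C a" "tgt C d = src C b"
  shows "diag a b \<cdot> col C c d = col C (a \<cdot> c) (b \<cdot> d)"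
  using assms by (simp add: diag_def mat_def)

lemma is_iso_diag:
  assumes "is_iso C f" "is_iso C g"
  shows "is_iso C (diag f g)"
proof -
  obtain f' where f': "f \<in> Arr C" "f' \<in> Arr C" "src C f' = tgt C f" "tgt C f' = src C f"
    "f' \<cdot> f = ident C (src C f)" "f \<cdot> f' = ident C (tgt C f)"
    using assms(1) by (rule is_isoE)
  obtain g' where g': "g \<in> Arr C" "g' \<in> Arr C" "src C g' = tgt C g" "tgt C g' = src C g"
    "g' \<cdot> g = ident C (src C g)" "g \<cdot> g' = ident C (tgt C g)"
    using assms(2) by (rule is_isoE)
  show ?thesis
    using f' g' by (intro is_isoI [of "diag f g" "diag f' g'"]) (simp_all add: diag_def matrix_simps)
qed

end

section \<open>Shift, exactness and direct sums of triangles\<close>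

context triangulated_category
begin

lemma sh_functor: "is_functor T T (shO T) (sh T)"
  using sh_equivalence by (simp add: is_equivalence_def)

lemma shO_Obj [simp]: "A \<in> Obj T \<Longrightarrow> shO T A \<in> Obj T"
  and sh_ident [simp]: "A \<in> Obj T \<Longrightarrow> sh T (ident T A) = ident T (shO T A)"
  using sh_functor by (auto simp: is_functor_def)

lemma sh_simps [simp]:
  assumes "f \<in> Arr T"
  shows "sh T f \<in> Arr T" "src T (sh T f) = shO T (src T f)" "tgt T (sh T f) = shO T (tgt T f)"
  using sh_functor assms by (auto simp: is_functor_def Hom_iff)

lemma sh_cmp [simp]:
  "\<lbrakk>f \<in> Arr T; g \<in> Arr T; tgt T f = src T g\<rbrakk> \<Longrightarrow> sh T (g \<cdot> f) = sh T g \<cdot> sh T f"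
  using sh_functor by (auto simp: is_functor_def Hom_iff)

lemma sh_madd_simp [simp]:
  "\<lbrakk>f \<in> Arr T; g \<in> Arr T; src T f = src T g; tgt T f = tgt T g\<rbrakk>
    \<Longrightarrow> sh T (f \<boxplus> g) = sh T f \<boxplus> sh T g"
  by (rule sh_madd) (auto simp: Hom_iff)

lemma sh_zarr [simp]:
  assumes "A \<in> Obj T" "B \<in> Obj T"
  shows "sh T (zarr T A B) = zarr T (shO T A) (shO T B)"
proof -
  have "sh T (zarr T A B) \<boxplus> sh T (zarr T A B) = sh T (zarr T A B)"
    using assms sh_madd_simp [of "zarr T A B" "zarr T A B"] by simp
  from madd_idem_imp_zarr [OF _ this] show ?thesis
    using assms by simp
qed

lemma sh_neg [simp]: "f \<in> Arr T \<Longrightarrow> sh T (neg T f) = neg T (sh T f)"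
  by (rule neg_unique) (simp_all flip: sh_madd_simp)

text \<open>Naturality of \<open>\<eta>\<close> gives faithfulness. For fullness, conjugating
  \<open>Ga k\<close> by \<open>\<eta>\<close> yields a map \<open>f\<close> with
  \<open>Ga (sh T f) = Ga k\<close>, and naturality of \<open>\<epsilon>\<close> makes the
  quasi-inverse faithful too, so that \<open>sh T f = k\<close>.\<close>

lemma sh_faithful_full:
  "\<And>f g. \<lbrakk>f \<in> Arr T; g \<in> Arr T; src T f = src T g; tgt T f = tgt T g; sh T f = sh T g\<rbrakk> \<Longrightarrow> f = g"
  "\<And>k A B. \<lbrakk>A \<in> Obj T; B \<in> Obj T; k \<in> Arr T; src T k = shO T A; tgt T k = shO T B\<rbrakk>
    \<Longrightarrow> \<exists>f\<in>Arr T. src T f = A \<and> tgt T f = B \<and> sh T f = k"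
proof -
  obtain Go Ga \<eta> \<epsilon> where G: "is_functor T T Go Ga"
    and \<eta>: "is_nat_iso T T (\<lambda>A. A) (\<lambda>f. f) (\<lambda>A. Go (shO T A)) (\<lambda>f. Ga (sh T f)) \<eta>"
    and \<epsilon>: "is_nat_iso T T (\<lambda>B. shO T (Go B)) (\<lambda>g. sh T (Ga g)) (\<lambda>B. B) (\<lambda>g. g) \<epsilon>"
    using sh_equivalence by (auto simp: is_equivalence_def)
  have Ga: "Ga f \<in> Arr T" "src T (Ga f) = Go (src T f)" "tgt T (Ga f) = Go (tgt T f)"
    if "f \<in> Arr T" for f
    using G that by (auto simp: is_functor_def Hom_iff)
  have \<eta>': "\<eta> A \<in> Arr T" "src T (\<eta> A) = A" "tgt T (\<eta> A) = Go (shO T A)" "is_iso T (\<eta> A)"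
    if "A \<in> Obj T" for A
    using \<eta> that by (auto simp: is_nat_iso_def Hom_iff)
  have \<eta>nat: "\<eta> (tgt T f) \<cdot> f = Ga (sh T f) \<cdot> \<eta> (src T f)" if "f \<in> Arr T" for f
    using \<eta> that by (auto simp: is_nat_iso_def Hom_iff)
  have \<epsilon>': "\<epsilon> A \<in> Arr T" "src T (\<epsilon> A) = shO T (Go A)" "tgt T (\<epsilon> A) = A" "is_iso T (\<epsilon> A)"
    if "A \<in> Obj T" for A
    using \<epsilon> that by (auto simp: is_nat_iso_def Hom_iff)
  have \<epsilon>nat: "\<epsilon> (tgt T f) \<cdot> sh T (Ga f) = f \<cdot> \<epsilon> (src T f)" if "f \<in> Arr T" for f
    using \<epsilon> that by (auto simp: is_nat_iso_def Hom_iff)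
  show "f = g" if "f \<in> Arr T" "g \<in> Arr T" "src T f = src T g" "tgt T f = tgt T g" "sh T f = sh T g" for f g
  proof (rule iso_cancel_left)
    show "is_iso T (\<eta> (tgt T f))" "f \<in> Arr T" "g \<in> Arr T" "tgt T f = src T (\<eta> (tgt T f))"
      "tgt T g = src T (\<eta> (tgt T f))"
      using that by (auto simp: \<eta>')
    show "\<eta> (tgt T f) \<cdot> f = \<eta> (tgt T f) \<cdot> g"
      using that \<eta>nat [of f] \<eta>nat [of g] by simp
  qed
  have Ga_inj: "f = g" if "f \<in> Arr T" "g \<in> Arr T" "src T f = src T g" "tgt T f = tgt T g" "Ga f = Ga g" for f g
  proof (rule iso_cancel_right)
    show "is_iso T (\<epsilon> (src T f))" "f \<in> Arr T" "g \<in> Arr T" "src T f = tgt T (\<epsilon> (src T f))"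
      "src T g = tgt T (\<epsilon> (src T f))"
      using that by (auto simp: \<epsilon>')
    show "f \<cdot> \<epsilon> (src T f) = g \<cdot> \<epsilon> (src T f)"
      using that \<epsilon>nat [of f] \<epsilon>nat [of g] by simp
  qed
  show "\<exists>f\<in>Arr T. src T f = A \<and> tgt T f = B \<and> sh T f = k"
    if "A \<in> Obj T" "B \<in> Obj T" "k \<in> Arr T" "src T k = shO T A" "tgt T k = shO T B" for k A B
  proof -
    have "is_iso T (\<eta> B)"
      using that by (simp add: \<eta>')
    then obtain i where i: "i \<in> Arr T" "src T i = tgt T (\<eta> B)" "tgt T i = src T (\<eta> B)"
      "\<eta> B \<cdot> i = ident T (tgt T (\<eta> B))"
      by (rule is_isoE)
    define f where "f = i \<cdot> (Ga k \<cdot> \<eta> A)"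
    have f: "f \<in> Arr T" "src T f = A" "tgt T f = B"
      using that i by (auto simp: f_def \<eta>' Ga)
    have "\<eta> B \<cdot> f = Ga k \<cdot> \<eta> A"
      using that i unfolding f_def by (subst cmp_reassoc [OF i(4)]) (auto simp: \<eta>' Ga)
    then have "Ga (sh T f) \<cdot> \<eta> A = Ga k \<cdot> \<eta> A"
      using \<eta>nat [of f] f by simp
    then have "Ga (sh T f) = Ga k"
      using that f by - (rule iso_cancel_right [of "\<eta> A"], simp_all add: \<eta>' Ga)
    then have "sh T f = k"
      using that f by - (rule Ga_inj, simp_all)
    with f show ?thesis
      by blast
  qed
qed

lemma is_iso_sh: assumes "is_iso T f" shows "is_iso T (sh T f)"
proof -
  obtain g where g: "f \<in> Arr T" "g \<in> Arr T" "src T g = tgt T f" "tgt T g = src T f"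
    "g \<cdot> f = ident T (src T f)" "f \<cdot> g = ident T (tgt T f)"
    using assms by (rule is_isoE)
  show ?thesis
    using g by (intro is_isoI [of _ "sh T g"]) (simp_all flip: sh_cmp)
qed

section \<open>Comparison of \<Sigma>A \<oplus> \<Sigma>B with \<Sigma>(A \<oplus> B)\<close>

lemma shsum_simps [simp]:
  assumes "A \<in> Obj T" "B \<in> Obj T"
  shows "shsum T A B \<in> Arr T" "src T (shsum T A B) = shO T A \<oplus> shO T B"
    "tgt T (shsum T A B) = shO T (A \<oplus> B)"
  using assms by (auto simp: shsum_def)

lemma shsum_col_eq:
  assumes "a \<in> Arr T" "b \<in> Arr T" "src T a = src T b" "tgt T a = shO T A" "tgt T b = shO T B"
    "A \<in> Obj T" "B \<in> Obj T"
  shows "shsum T A B \<cdot> col T a b = (sh T (inl T A B) \<cdot> a) \<boxplus> (sh T (inr T A B) \<cdot> b)"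
  using assms by (simp add: shsum_def)

lemma sh_col [simp]:
  assumes "a \<in> Arr T" "b \<in> Arr T" "src T a = src T b"
  shows "sh T (col T a b) = shsum T (tgt T a) (tgt T b) \<cdot> col T (sh T a) (sh T b)"
  using assms by (simp add: shsum_col_eq) (simp add: col_def)

lemma sh_prl_inl_prr_inr:
  assumes "A \<in> Obj T" "B \<in> Obj T"
  shows "(sh T (inl T A B) \<cdot> sh T (prl T A B)) \<boxplus> (sh T (inr T A B) \<cdot> sh T (prr T A B)) = ident T (shO T (A \<oplus> B))"
  using assms by (simp add: inl_prl_inr_prr flip: sh_cmp sh_madd_simp)

lemma sh_row_shsum [simp]:
  assumes "a \<in> Arr T" "b \<in> Arr T" "tgt T a = tgt T b" "src T a = A" "src T b = B"
  shows "sh T (row T a b) \<cdot> shsum T A B = row T (sh T a) (sh T b)"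
proof -
  have "sh T (row T a b) \<cdot> shsum T A B = row T (sh T (row T a b \<cdot> inl T A B)) (sh T (row T a b \<cdot> inr T A B))"
    using assms by (auto simp: shsum_def)
  then show ?thesis
    using assms by (simp add: row_inl row_inr)
qed

lemma sh_row_shsum_cmp [simp]:
  assumes "a \<in> Arr T" "b \<in> Arr T" "tgt T a = tgt T b" "src T a = A" "src T b = B"
    "f \<in> Arr T" "tgt T f = shO T A \<oplus> shO T B"
  shows "sh T (row T a b) \<cdot> (shsum T A B \<cdot> f) = row T (sh T a) (sh T b) \<cdot> f"
  using assms by (subst cmp_reassoc [OF sh_row_shsum]) auto

lemma sh_proj_shsum:
  assumes "a \<in> Arr T" "b \<in> Arr T" "src T a = src T b" "tgt T a = shO T A" "tgt T b = shO T B"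
    "A \<in> Obj T" "B \<in> Obj T"
  shows "sh T (prl T A B) \<cdot> (shsum T A B \<cdot> col T a b) = a"
    "sh T (prr T A B) \<cdot> (shsum T A B \<cdot> col T a b) = b"
  using assms by (simp_all add: prl_eq_row prr_eq_row)

lemma shsum_col_eq_iff [simp]:
  assumes "a \<in> Arr T" "b \<in> Arr T" "src T a = src T b" "tgt T a = shO T A" "tgt T b = shO T B"
    "c \<in> Arr T" "d \<in> Arr T" "src T c = src T d" "tgt T c = shO T A" "tgt T d = shO T B"
    "A \<in> Obj T" "B \<in> Obj T"
  shows "shsum T A B \<cdot> col T a b = shsum T A B \<cdot> col T c d \<longleftrightarrow> a = c \<and> b = d"
  using assms sh_proj_shsum [of a b A B] sh_proj_shsum [of c d A B] by metis

lemma shsum_eta: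
  assumes "f \<in> Arr T" "tgt T f = shO T (A \<oplus> B)" "A \<in> Obj T" "B \<in> Obj T"
  shows "shsum T A B \<cdot> col T (sh T (prl T A B) \<cdot> f) (sh T (prr T A B) \<cdot> f) = f"
proof -
  have "shsum T A B \<cdot> col T (sh T (prl T A B) \<cdot> f) (sh T (prr T A B) \<cdot> f) =
      ((sh T (inl T A B) \<cdot> sh T (prl T A B)) \<boxplus> (sh T (inr T A B) \<cdot> sh T (prr T A B))) \<cdot> f"
    using assms by (simp add: shsum_col_eq)
  then show ?thesis
    using assms by (simp add: sh_prl_inl_prr_inr)
qed

lemma shsum_madd [simp]:
  assumes "a \<in> Arr T" "b \<in> Arr T" "src T a = src T b" "tgt T a = shO T A" "tgt T b = shO T B"
    "c \<in> Arr T" "d \<in> Arr T" "src T c = src T d" "src T b = src T d" "tgt T c = shO T A" "tgt T d = shO T B"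
    "A \<in> Obj T" "B \<in> Obj T"
  shows "(shsum T A B \<cdot> col T a b) \<boxplus> (shsum T A B \<cdot> col T c d) = shsum T A B \<cdot> col T (a \<boxplus> c) (b \<boxplus> d)"
  using assms by (simp flip: cmp_madd_simp)

lemma shsum_neg [simp]:
  assumes "a \<in> Arr T" "b \<in> Arr T" "src T a = src T b" "tgt T a = shO T A" "tgt T b = shO T B"
    "A \<in> Obj T" "B \<in> Obj T"
  shows "neg T (shsum T A B \<cdot> col T a b) = shsum T A B \<cdot> col T (neg T a) (neg T b)"
  using assms by (simp flip: cmp_neg)

lemma shsum_row [simp]:
  assumes "a \<in> Arr T" "b \<in> Arr T" "src T a = src T b" "tgt T a = shO T A" "tgt T b = shO T B"
    "c \<in> Arr T" "d \<in> Arr T" "src T c = src T d" "tgt T c = shO T A" "tgt T d = shO T B"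
    "A \<in> Obj T" "B \<in> Obj T"
  shows "row T (shsum T A B \<cdot> col T a b) (shsum T A B \<cdot> col T c d)
    = shsum T A B \<cdot> col T (row T a c) (row T b d)"
  using assms by (simp flip: cmp_row row_col_swap)

lemma shsum_zarr:
  "\<lbrakk>A \<in> Obj T; B \<in> Obj T; D \<in> Obj T\<rbrakk>
    \<Longrightarrow> zarr T D (shO T (A \<oplus> B)) = shsum T A B \<cdot> col T (zarr T D (shO T A)) (zarr T D (shO T B))"
  by (simp flip: col_zarr)

text \<open>The inverse is the column of the shifted projections, because an additive functor
  preserves the biproduct identities.\<close>

lemma is_iso_shsum:
  assumes "A \<in> Obj T" "B \<in> Obj T" shows "is_iso T (shsum T A B)"
  using assms
  by (intro is_isoI [of _ "col T (sh T (prl T A B)) (sh T (prr T A B))"])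
    (simp_all add: shsum_col_eq sh_prl_inl_prr_inr ident_osum, simp_all add: prl_eq_row prr_eq_row)

section \<open>Exact Hom sequences and the five lemma\<close>

lemma candidates_iff:
  "(u, v, w) \<in> candidates T \<longleftrightarrow> u \<in> Arr T \<and> v \<in> Arr T \<and> w \<in> Arr T \<and>
     tgt T u = src T v \<and> tgt T v = src T w \<and> tgt T w = shO T (src T u)"
  by (simp add: candidates_def)

lemma TriD:
  assumes "(u, v, w) \<in> Tri T"
  shows "u \<in> Arr T" "v \<in> Arr T" "w \<in> Arr T" "tgt T u = src T v" "tgt T v = src T w"
    "tgt T w = shO T (src T u)"
  using assms Tri_candidates by (auto simp: candidates_iff)

lemma Tri_rotateD: "(u, v, w) \<in> Tri T \<Longrightarrow> (v, w, neg T (sh T u)) \<in> Tri T"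
  using Tri_rotate Tri_candidates by blast

text \<open>The trivial triangle on the source of \<open>u\<close> maps to the given one over the
  identity and \<open>u\<close>; the third component of this map shows that
  \<open>v \<cdot> u\<close> factors through the zero object.\<close>

lemma Tri_cmp_zero:
  assumes "(u, v, w) \<in> Tri T"
  shows "v \<cdot> u = zarr T (src T u) (tgt T v)"
proof -
  note t = TriD [OF assms]
  have "(ident T (src T u), zarr T (src T u) (zobj T), zarr T (zobj T) (shO T (src T u))) \<in> Tri T"
    using t by (intro Tri_ident) simp
  from Tri_fill [OF this assms, of "ident T (src T u)" u] obtain h where
    "h \<in> Arr T" "src T h = zobj T" "tgt T h = tgt T v"
    "h \<cdot> zarr T (src T u) (zobj T) = v \<cdot> u"
    using t by (auto simp: Hom_iff)
  then show ?thesis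
    using t by (metis cmp_zarr src_in_Obj)
qed

text \<open>Exactness of \<open>Hom(W, -)\<close> at the middle term, for every \<open>W\<close>.\<close>

definition exact_at :: "'a \<Rightarrow> 'a \<Rightarrow> bool" where
  "exact_at u v \<longleftrightarrow> u \<in> Arr T \<and> v \<in> Arr T \<and> tgt T u = src T v \<and>
     v \<cdot> u = zarr T (src T u) (tgt T v) \<and>
     (\<forall>y\<in>Arr T. tgt T y = src T v \<longrightarrow> v \<cdot> y = zarr T (src T y) (tgt T v) \<longrightarrow>
        (\<exists>x\<in>Arr T. src T x = src T y \<and> tgt T x = src T u \<and> u \<cdot> x = y))"

lemma exact_atE:
  assumes "exact_at u v" "y \<in> Arr T" "tgt T y = src T v" "v \<cdot> y = zarr T (src T y) (tgt T v)"
  obtains x where "x \<in> Arr T" "src T x = src T y" "tgt T x = src T u" "u \<cdot> x = y"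
  using assms unfolding exact_at_def by blast

lemma exact_at_zero: "exact_at u v \<Longrightarrow> v \<cdot> u = zarr T (src T u) (tgt T v)"
  by (simp add: exact_at_def)

text \<open>If y: W -> Y satisfies v y = 0, then y and the zero map send the rotated trivial
  triangle W -> 0 -> \<Sigma>W to the rotated given one. The third component of a fill-in lifts
  \<Sigma>y along \<Sigma>u.\<close>

lemma Tri_exact_at:
  assumes "(u, v, w) \<in> Tri T"
  shows "exact_at u v"
  unfolding exact_at_def
proof (intro conjI ballI impI)
  note t = TriD [OF assms]
  show "u \<in> Arr T" "v \<in> Arr T" "tgt T u = src T v" "v \<cdot> u = zarr T (src T u) (tgt T v)"
    using t Tri_cmp_zero [OF assms] by auto
  fix y
  assume y: "y \<in> Arr T" "tgt T y = src T v" "v \<cdot> y = zarr T (src T y) (tgt T v)"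
  let ?W = "src T y"
  have "(ident T ?W, zarr T ?W (zobj T), zarr T (zobj T) (shO T ?W)) \<in> Tri T"
    using y by (intro Tri_ident) simp
  from Tri_rotateD [OF this]
  have "(zarr T ?W (zobj T), zarr T (zobj T) (shO T ?W), neg T (ident T (shO T ?W))) \<in> Tri T"
    using y by simp
  from Tri_fill [OF this Tri_rotateD [OF assms], of y "zarr T (zobj T) (src T w)"]
  obtain h where h: "h \<in> Arr T" "src T h = shO T ?W" "tgt T h = shO T (src T u)"
    "sh T y \<cdot> neg T (ident T (shO T ?W)) = neg T (sh T u) \<cdot> h"
    using t y by (auto simp: Hom_iff)
  \<comment> \<open>The lift is desuspended by fullness; the signs of the two rotations cancel, and
    faithfulness then gives \<open>y = u \<cdot> x\<close>.\<close>
  obtain x where x: "x \<in> Arr T" "src T x = ?W" "tgt T x = src T u" "sh T x = h"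
    using sh_faithful_full(2) [of ?W "src T u" h] h t y by auto
  have "sh T y = sh T (u \<cdot> x)"
    using h x t y by simp
  then have "y = u \<cdot> x"
    using t y x by - (rule sh_faithful_full(1), simp_all)
  with x show "\<exists>x\<in>Arr T. src T x = src T y \<and> tgt T x = src T u \<and> u \<cdot> x = y"
    by blast
qed

text \<open>Rotating a triangle twice puts a sign on its maps, whereas the exact sequence is wanted
  without signs.\<close>

lemma exact_at_neg:
  assumes "exact_at u (neg T v)" "v \<in> Arr T"
  shows "exact_at u v"
  unfolding exact_at_def
proof (intro conjI ballI impI)
  show t: "u \<in> Arr T" "v \<in> Arr T" "tgt T u = src T v"
    using assms by (simp_all add: exact_at_def)
  show "v \<cdot> u = zarr T (src T u) (tgt T v)"
    using exact_at_zero [OF assms(1)] t by simp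
  fix y
  assume "y \<in> Arr T" "tgt T y = src T v" "v \<cdot> y = zarr T (src T y) (tgt T v)"
  with t exact_atE [OF assms(1), of y] show "\<exists>x\<in>Arr T. src T x = src T y \<and> tgt T x = src T u \<and> u \<cdot> x = y"
    by auto
qed

text \<open>The part of the long Hom sequence that the five lemma consumes. Exact triangles satisfy
  it, and, unlike exactness of a triangle, it passes to retracts and sums by an elementary
  chase.\<close>

definition pretriangle :: "'a \<Rightarrow> 'a \<Rightarrow> 'a \<Rightarrow> bool" where
  "pretriangle u v w \<longleftrightarrow>
     (u, v, w) \<in> candidates T \<and> exact_at u v \<and> exact_at v w \<and> exact_at w (sh T u)"

lemma Tri_pretriangle:
  assumes "(u, v, w) \<in> Tri T"
  shows "pretriangle u v w"
proof -
  note r = Tri_rotateD [OF assms]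
  show ?thesis
    using Tri_exact_at [OF assms] Tri_exact_at [OF r] Tri_exact_at [OF Tri_rotateD [OF r]]
      Tri_candidates assms TriD [OF assms]
    by (auto simp: pretriangle_def intro: exact_at_neg)
qed

lemma tri_map_iff:
  "tri_map T (u, v, w) (u', v', w') (f, g, h) \<longleftrightarrow>
     f \<in> Arr T \<and> src T f = src T u \<and> tgt T f = src T u' \<and>
     g \<in> Arr T \<and> src T g = src T v \<and> tgt T g = src T v' \<and>
     h \<in> Arr T \<and> src T h = src T w \<and> tgt T h = src T w' \<and>
     g \<cdot> u = u' \<cdot> f \<and> h \<cdot> v = v' \<cdot> g \<and> sh T f \<cdot> w = w' \<cdot> h"
  by (auto simp: Hom_iff)

text \<open>A diagram chase in Hom(W, -), where W is the source of the given map. Surjectivity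
  applied to the identity of \<open>src T w'\<close> gives a right inverse \<open>k\<close>;
  injectivity applied to \<open>k \<cdot> h\<close> minus the identity makes it two-sided.\<close>

lemma five_lemma:
  assumes p: "pretriangle u v w" and p': "pretriangle u' v' w'"
    and m: "tri_map T (u, v, w) (u', v', w') (f, g, h)"
    and f: "is_iso T f" and g: "is_iso T g"
  shows "is_iso T h"
proof -
  have t [simp]: "u \<in> Arr T" "v \<in> Arr T" "w \<in> Arr T" "tgt T u = src T v" "tgt T v = src T w"
    "tgt T w = shO T (src T u)" "u' \<in> Arr T" "v' \<in> Arr T" "w' \<in> Arr T" "tgt T u' = src T v'"
    "tgt T v' = src T w'" "tgt T w' = shO T (src T u')"
    using p p' by (auto simp: pretriangle_def candidates_iff)
  have e: "exact_at u v" "exact_at v w" "exact_at w (sh T u)"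
    "exact_at u' v'" "exact_at v' w'" "exact_at w' (sh T u')"
    using p p' by (auto simp: pretriangle_def)
  have mt [simp]: "f \<in> Arr T" "src T f = src T u" "tgt T f = src T u'"
     "g \<in> Arr T" "src T g = src T v" "tgt T g = src T v'"
     "h \<in> Arr T" "src T h = src T w" "tgt T h = src T w'"
    and mc: "g \<cdot> u = u' \<cdot> f" "h \<cdot> v = v' \<cdot> g" "sh T f \<cdot> w = w' \<cdot> h"
    using m by (auto simp: Hom_iff)
  obtain f' where f' [simp]: "f' \<in> Arr T" "src T f' = src T u'" "tgt T f' = src T u"
    and ff': "f' \<cdot> f = ident T (src T u)" "f \<cdot> f' = ident T (src T u')"
    using f by (rule is_isoE) simp
  obtain g' where g' [simp]: "g' \<in> Arr T" "src T g' = src T v'" "tgt T g' = src T v"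
    and gg': "g' \<cdot> g = ident T (src T v)" "g \<cdot> g' = ident T (src T v')"
    using g by (rule is_isoE) simp
  have surj: "\<exists>z\<in>Arr T. src T z = src T z' \<and> tgt T z = src T w \<and> h \<cdot> z = z'"
    if z' [simp]: "z' \<in> Arr T" "tgt T z' = src T w'" for z'
  proof -
    let ?W = "src T z'"
    \<comment> \<open>The value that \<open>w \<cdot> z\<close> is forced to take if
      \<open>h \<cdot> z = z'\<close>; it lifts along \<open>w\<close> because \<open>sh T u\<close>
      kills it.\<close>
    let ?x = "sh T f' \<cdot> (w' \<cdot> z')"
    have gu: "u \<cdot> f' = g' \<cdot> u'"
    proof (rule iso_cancel_left [OF g])
      have "g \<cdot> (u \<cdot> f') = u' \<cdot> (f \<cdot> f')"
        by (subst cmp_reassoc [OF mc(1)]) simp_all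
      also have "\<dots> = g \<cdot> (g' \<cdot> u')"
        by (subst cmp_reassoc [OF gg'(2)]) (simp_all add: ff')
      finally show "g \<cdot> (u \<cdot> f') = g \<cdot> (g' \<cdot> u')" .
    qed simp_all
    have "sh T u \<cdot> ?x = sh T (u \<cdot> f') \<cdot> (w' \<cdot> z')"
      by simp
    also have "\<dots> = sh T g' \<cdot> ((sh T u' \<cdot> w') \<cdot> z')"
      by (simp add: gu)
    also have "\<dots> = zarr T ?W (tgt T (sh T u))"
      by (subst exact_at_zero [OF e(6)]) simp
    finally obtain z where z [simp]: "z \<in> Arr T" "src T z = ?W" "tgt T z = src T w" and wz: "w \<cdot> z = ?x"
      using exact_atE [OF e(3), of ?x] by auto
    have "w' \<cdot> (h \<cdot> z) = sh T f \<cdot> (w \<cdot> z)"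
      by (simp add: cmp_reassoc [OF mc(3)])
    also have "\<dots> = sh T (f \<cdot> f') \<cdot> (w' \<cdot> z')"
      by (simp add: wz)
    also have "\<dots> = w' \<cdot> z'"
      by (simp add: ff' del: sh_cmp)
    \<comment> \<open>The first guess \<open>z\<close> is only correct after applying
      \<open>w'\<close>. The remaining difference comes from \<open>v'\<close>, and adding the image
      of \<open>g' \<cdot> y'\<close> under \<open>v\<close> corrects it.\<close>
    finally have "w' \<cdot> (z' \<boxplus> neg T (h \<cdot> z)) = zarr T ?W (tgt T w')"
      by simp
    then obtain y' where y' [simp]: "y' \<in> Arr T" "src T y' = ?W" "tgt T y' = src T v'"
      and vy': "v' \<cdot> y' = z' \<boxplus> neg T (h \<cdot> z)"
      using exact_atE [OF e(5), of "z' \<boxplus> neg T (h \<cdot> z)"] by auto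
    have "h \<cdot> (v \<cdot> (g' \<cdot> y')) = v' \<cdot> ((g \<cdot> g') \<cdot> y')"
      by (simp add: cmp_reassoc [OF mc(2)])
    also have "\<dots> = z' \<boxplus> neg T (h \<cdot> z)"
      by (subst gg') (simp add: vy')
    finally have "h \<cdot> ((v \<cdot> (g' \<cdot> y')) \<boxplus> z) = z'"
      by simp
    then show ?thesis
      by (intro bexI [of _ "(v \<cdot> (g' \<cdot> y')) \<boxplus> z"]) simp_all
  qed
  have inj: "z = zarr T (src T z) (src T w)"
    if z [simp]: "z \<in> Arr T" "tgt T z = src T w" and hz: "h \<cdot> z = zarr T (src T z) (src T w')" for z
  proof -
    let ?W = "src T z"
    have "sh T f \<cdot> (w \<cdot> z) = sh T f \<cdot> zarr T ?W (shO T (src T u))"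
      by (simp add: cmp_reassoc [OF mc(3)] hz)
    then have "w \<cdot> z = zarr T ?W (shO T (src T u))"
      by - (rule iso_cancel_left [OF is_iso_sh [OF f]], simp_all)
    then obtain y where y [simp]: "y \<in> Arr T" "src T y = ?W" "tgt T y = src T v" and vy: "v \<cdot> y = z"
      using exact_atE [OF e(2), of z] by auto
    have "v' \<cdot> (g \<cdot> y) = h \<cdot> z"
      by (simp add: cmp_reassoc [OF mc(2)] flip: vy)
    then obtain x' where x' [simp]: "x' \<in> Arr T" "src T x' = ?W" "tgt T x' = src T u'"
      and ux': "u' \<cdot> x' = g \<cdot> y"
      using exact_atE [OF e(4), of "g \<cdot> y"] hz by auto
    have "g \<cdot> (u \<cdot> (f' \<cdot> x')) = u' \<cdot> ((f \<cdot> f') \<cdot> x')"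
      by (simp add: cmp_reassoc [OF mc(1)])
    also have "\<dots> = g \<cdot> y"
      by (subst ff') (simp add: ux')
    finally have "y = u \<cdot> (f' \<cdot> x')"
      by - (rule iso_cancel_left [OF g], simp_all)
    then have "z = (v \<cdot> u) \<cdot> (f' \<cdot> x')"
      by (simp flip: vy)
    then show ?thesis
      by (subst (asm) exact_at_zero [OF e(1)]) simp
  qed
  obtain k where k [simp]: "k \<in> Arr T" "src T k = src T w'" "tgt T k = src T w"
    and hk: "h \<cdot> k = ident T (src T w')"
    using surj [of "ident T (src T w')"] by auto
  have "h \<cdot> ((k \<cdot> h) \<boxplus> neg T (ident T (src T w))) = zarr T (src T w) (src T w')"
    by (simp add: cmp_reassoc [OF hk])
  from inj [OF _ _ this [THEN trans]] have "(k \<cdot> h) \<boxplus> neg T (ident T (src T w)) = zarr T (src T w) (src T w)"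
    by simp
  then have "k \<cdot> h = ident T (src T w)"
    by (rule madd_neg_eq_zarrD) simp_all
  then show ?thesis
    using hk by (intro is_isoI [of h k]) simp_all
qed

lemma Tri_iso_iff:
  assumes c: "(u, v, w) \<in> candidates T" "(u', v', w') \<in> candidates T"
    and m: "tri_map T (u, v, w) (u', v', w') (f, g, h)"
    and i: "is_iso T f" "is_iso T g" "is_iso T h"
  shows "(u, v, w) \<in> Tri T \<longleftrightarrow> (u', v', w') \<in> Tri T"
proof
  show "(u', v', w') \<in> Tri T" if "(u, v, w) \<in> Tri T"
    by (rule Tri_iso [OF that c(2) m i])
  obtain f' where f': "f' \<in> Arr T" "src T f' = tgt T f" "tgt T f' = src T f"
    "f' \<cdot> f = ident T (src T f)" "f \<cdot> f' = ident T (tgt T f)" and fi: "is_iso T f'"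
    using i(1) by (rule is_isoE)
  obtain g' where g': "g' \<in> Arr T" "src T g' = tgt T g" "tgt T g' = src T g"
    "g' \<cdot> g = ident T (src T g)" "g \<cdot> g' = ident T (tgt T g)" and gi: "is_iso T g'"
    using i(2) by (rule is_isoE)
  obtain h' where h': "h' \<in> Arr T" "src T h' = tgt T h" "tgt T h' = src T h"
    "h' \<cdot> h = ident T (src T h)" "h \<cdot> h' = ident T (tgt T h)" and hi: "is_iso T h'"
    using i(3) by (rule is_isoE)
  have "g' \<cdot> u' = u \<cdot> f'"
    using c m f' g' by (intro iso_square_inverse [of g u u' f]) (simp_all add: tri_map_iff candidates_iff del: tri_map.simps)
  moreover have "h' \<cdot> v' = v \<cdot> g'"
    using c m h' g' by (intro iso_square_inverse [of h v v' g]) (simp_all add: tri_map_iff candidates_iff del: tri_map.simps)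
  moreover have "sh T f' \<cdot> w' = w \<cdot> h'"
    using c m h' f' 
    by (intro iso_square_inverse [of "sh T f" w w' h])
      (simp_all add: tri_map_iff candidates_iff del: tri_map.simps sh_cmp flip: sh_cmp)
  ultimately have "tri_map T (u', v', w') (u, v, w) (f', g', h')"
    using c m f' g' h' by (simp add: Hom_iff)
  then show "(u, v, w) \<in> Tri T" if "(u', v', w') \<in> Tri T"
    using Tri_iso [OF that c(1)] fi gi hi by blast
qed

section \<open>Retracts of exact triangles\<close>

lemma exact_at_retract:
  assumes e: "exact_at u' v'"
    and t [simp]: "u \<in> Arr T" "v \<in> Arr T" "tgt T u = src T v"
      "i\<^sub>X \<in> Arr T" "src T i\<^sub>X = src T u" "tgt T i\<^sub>X = src T u'"
      "i\<^sub>Y \<in> Arr T" "src T i\<^sub>Y = src T v" "tgt T i\<^sub>Y = src T v'"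
      "i\<^sub>Z \<in> Arr T" "src T i\<^sub>Z = tgt T v" "tgt T i\<^sub>Z = tgt T v'"
      "p\<^sub>X \<in> Arr T" "src T p\<^sub>X = src T u'" "tgt T p\<^sub>X = src T u"
      "p\<^sub>Y \<in> Arr T" "src T p\<^sub>Y = src T v'" "tgt T p\<^sub>Y = src T v"
      "p\<^sub>Z \<in> Arr T" "src T p\<^sub>Z = tgt T v'" "tgt T p\<^sub>Z = tgt T v"
    and c: "i\<^sub>Y \<cdot> u = u' \<cdot> i\<^sub>X" "i\<^sub>Z \<cdot> v = v' \<cdot> i\<^sub>Y" "p\<^sub>Y \<cdot> u' = u \<cdot> p\<^sub>X"
      "p\<^sub>Y \<cdot> i\<^sub>Y = ident T (src T v)" "p\<^sub>Z \<cdot> i\<^sub>Z = ident T (tgt T v)"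
  shows "exact_at u v"
  unfolding exact_at_def
proof (intro conjI ballI impI t)
  have t' [simp]: "u' \<in> Arr T" "v' \<in> Arr T" "tgt T u' = src T v'"
    using e by (auto simp: exact_at_def)
  have "v \<cdot> u = p\<^sub>Z \<cdot> (i\<^sub>Z \<cdot> (v \<cdot> u))"
    by (subst cmp_reassoc [OF c(5)]) simp_all
  also have "\<dots> = p\<^sub>Z \<cdot> (v' \<cdot> (u' \<cdot> i\<^sub>X))"
    by (simp add: cmp_reassoc [OF c(2)] c(1))
  also have "\<dots> = zarr T (src T u) (tgt T v)"
    by (simp add: cmp_reassoc [OF exact_at_zero [OF e]])
  finally show "v \<cdot> u = zarr T (src T u) (tgt T v)" .
  fix y
  assume y [simp]: "y \<in> Arr T" "tgt T y = src T v" and vy: "v \<cdot> y = zarr T (src T y) (tgt T v)"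
  \<comment> \<open>The lift is sought in the larger sequence and brought back by
    \<open>p\<^sub>X\<close>.\<close>
  have "v' \<cdot> (i\<^sub>Y \<cdot> y) = i\<^sub>Z \<cdot> (v \<cdot> y)"
    by (simp add: cmp_reassoc [OF c(2)])
  then obtain x where x [simp]: "x \<in> Arr T" "src T x = src T y" "tgt T x = src T u'" and ux: "u' \<cdot> x = i\<^sub>Y \<cdot> y"
    using exact_atE [OF e, of "i\<^sub>Y \<cdot> y"] vy by auto
  have "u \<cdot> (p\<^sub>X \<cdot> x) = p\<^sub>Y \<cdot> (u' \<cdot> x)"
    by (simp add: cmp_reassoc [OF c(3)])
  also have "\<dots> = y"
    unfolding ux by (subst cmp_reassoc [OF c(4)]) simp_all
  finally show "\<exists>x\<in>Arr T. src T x = src T y \<and> tgt T x = src T u \<and> u \<cdot> x = y"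
    by (intro bexI [of _ "p\<^sub>X \<cdot> x"]) simp_all
qed

text \<open>A triangle \<open>(u, v\<^sub>1, w\<^sub>1)\<close> on \<open>u\<close> maps to the retract \<open>(u, v, w)\<close> through \<open>t'\<close>;
  the five lemma applies because the retract inherits exactness of the Hom sequences.\<close>

lemma Tri_retract:
  assumes t': "(u', v', w') \<in> Tri T" and cand: "(u, v, w) \<in> candidates T"
    and i: "tri_map T (u, v, w) (u', v', w') (i\<^sub>X, i\<^sub>Y, i\<^sub>Z)"
    and p: "tri_map T (u', v', w') (u, v, w) (p\<^sub>X, p\<^sub>Y, p\<^sub>Z)"
    and pi: "p\<^sub>X \<cdot> i\<^sub>X = ident T (src T u)" "p\<^sub>Y \<cdot> i\<^sub>Y = ident T (src T v)"
      "p\<^sub>Z \<cdot> i\<^sub>Z = ident T (src T w)"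
  shows "(u, v, w) \<in> Tri T"
proof -
  have t [simp]: "u \<in> Arr T" "v \<in> Arr T" "w \<in> Arr T" "tgt T u = src T v" "tgt T v = src T w"
    "tgt T w = shO T (src T u)"
    using cand by (auto simp: candidates_iff)
  note t' [simp] = TriD [OF \<open>(u', v', w') \<in> Tri T\<close>]
  have m [simp]:
      "i\<^sub>X \<in> Arr T" "src T i\<^sub>X = src T u" "tgt T i\<^sub>X = src T u'"
      "i\<^sub>Y \<in> Arr T" "src T i\<^sub>Y = src T v" "tgt T i\<^sub>Y = src T v'"
      "i\<^sub>Z \<in> Arr T" "src T i\<^sub>Z = src T w" "tgt T i\<^sub>Z = src T w'"
      "p\<^sub>X \<in> Arr T" "src T p\<^sub>X = src T u'" "tgt T p\<^sub>X = src T u"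
      "p\<^sub>Y \<in> Arr T" "src T p\<^sub>Y = src T v'" "tgt T p\<^sub>Y = src T v"
      "p\<^sub>Z \<in> Arr T" "src T p\<^sub>Z = src T w'" "tgt T p\<^sub>Z = src T w"
    and mc: "i\<^sub>Y \<cdot> u = u' \<cdot> i\<^sub>X" "i\<^sub>Z \<cdot> v = v' \<cdot> i\<^sub>Y" "sh T i\<^sub>X \<cdot> w = w' \<cdot> i\<^sub>Z"
      "p\<^sub>Y \<cdot> u' = u \<cdot> p\<^sub>X" "p\<^sub>Z \<cdot> v' = v \<cdot> p\<^sub>Y" "sh T p\<^sub>X \<cdot> w' = w \<cdot> p\<^sub>Z"
    using i p by (auto simp: Hom_iff)
  note sc [simp] = sh_cmp [symmetric] and [simp del] = sh_cmp
  have "pretriangle u' v' w'"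
    using t' by (intro Tri_pretriangle \<open>(u', v', w') \<in> Tri T\<close>)
  then have e: "exact_at u' v'" "exact_at v' w'" "exact_at w' (sh T u')"
    by (auto simp: pretriangle_def)
  have "exact_at u v"
    by (rule exact_at_retract [OF e(1), of _ _ i\<^sub>X i\<^sub>Y i\<^sub>Z p\<^sub>X p\<^sub>Y p\<^sub>Z]) (simp_all add: mc pi)
  moreover have "exact_at v w"
    by (rule exact_at_retract [OF e(2), of _ _ i\<^sub>Y i\<^sub>Z "sh T i\<^sub>X" p\<^sub>Y p\<^sub>Z "sh T p\<^sub>X"]) (simp_all add: mc pi)
  moreover have "exact_at w (sh T u)"
    by (rule exact_at_retract [OF e(3), of _ _ i\<^sub>Z "sh T i\<^sub>X" "sh T i\<^sub>Y" p\<^sub>Z "sh T p\<^sub>X" "sh T p\<^sub>Y"])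
      (simp_all add: mc pi)
  ultimately have pt: "pretriangle u v w"
    using cand by (simp add: pretriangle_def)
  obtain v\<^sub>1 w\<^sub>1 where t1: "(u, v\<^sub>1, w\<^sub>1) \<in> Tri T"
    using Tri_extend t(1) by blast
  note t1t [simp] = TriD(2-) [OF t1]
  obtain k where k [simp]: "k \<in> Arr T" "src T k = src T w\<^sub>1" "tgt T k = src T w'"
    and kc: "k \<cdot> v\<^sub>1 = v' \<cdot> i\<^sub>Y" "sh T i\<^sub>X \<cdot> w\<^sub>1 = w' \<cdot> k"
    using Tri_fill [OF t1 \<open>(u', v', w') \<in> Tri T\<close>, of i\<^sub>X i\<^sub>Y] by (auto simp: Hom_iff mc)
  have src_v1: "src T v\<^sub>1 = src T v"
    using t1t(3) by simp
  have m1: "tri_map T (u, v\<^sub>1, w\<^sub>1) (u, v, w) (ident T (src T u), ident T (src T v), p\<^sub>Z \<cdot> k)"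
  proof -
    have "p\<^sub>Z \<cdot> (k \<cdot> v\<^sub>1) = v \<cdot> (p\<^sub>Y \<cdot> i\<^sub>Y)"
      unfolding kc(1) using mc(5) by (simp add: cmp_reassoc [OF mc(5)])
    then have "(p\<^sub>Z \<cdot> k) \<cdot> v\<^sub>1 = v"
      by (simp add: pi src_v1)
    moreover have "w \<cdot> (p\<^sub>Z \<cdot> k) = sh T p\<^sub>X \<cdot> (w' \<cdot> k)"
      by (simp add: cmp_reassoc [OF mc(6)])
    then have "w \<cdot> (p\<^sub>Z \<cdot> k) = sh T (p\<^sub>X \<cdot> i\<^sub>X) \<cdot> w\<^sub>1"
      by (simp flip: kc(2) add: cmp_reassoc [OF sc])
    then have "w \<cdot> (p\<^sub>Z \<cdot> k) = w\<^sub>1"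
      by (simp add: pi)
    ultimately show ?thesis
      by (simp add: Hom_iff src_v1)
  qed
  have "is_iso T (p\<^sub>Z \<cdot> k)"
    by (rule five_lemma [OF Tri_pretriangle [OF t1] pt m1]) simp_all
  then show ?thesis
    by (intro Tri_iso [OF t1 cand m1]) simp_all
qed

section \<open>Direct sums of exact triangles\<close>

lemma exact_at_diag:
  assumes e: "exact_at u v" "exact_at u' v'"
  shows "exact_at (diag u u') (diag v v')"
  unfolding exact_at_def
proof (intro conjI ballI impI)
  have t [simp]: "u \<in> Arr T" "v \<in> Arr T" "tgt T u = src T v" "u' \<in> Arr T" "v' \<in> Arr T" "tgt T u' = src T v'"
    using e by (auto simp: exact_at_def)
  show "diag u u' \<in> Arr T" "diag v v' \<in> Arr T" "tgt T (diag u u') = src T (diag v v')"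
    by simp_all
  show "diag v v' \<cdot> diag u u' = zarr T (src T (diag u u')) (tgt T (diag v v'))"
    by (simp add: e [THEN exact_at_zero] diag_def matrix_simps)
  fix y
  assume y: "y \<in> Arr T" "tgt T y = src T (diag v v')"
    and vy: "diag v v' \<cdot> y = zarr T (src T y) (tgt T (diag v v'))"
  define y1 y2 where "y1 = prl T (src T v) (src T v') \<cdot> y" and "y2 = prr T (src T v) (src T v') \<cdot> y"
  have y1 [simp]: "y1 \<in> Arr T" "src T y1 = src T y" "tgt T y1 = src T v"
    and y2 [simp]: "y2 \<in> Arr T" "src T y2 = src T y" "tgt T y2 = src T v'"
    using y by (auto simp: y1_def y2_def)
  have eta: "y = col T y1 y2"
    using y by (simp add: y1_def y2_def col_eta del: col_cmp)
  have "v \<cdot> y1 = zarr T (src T y) (tgt T v)" "v' \<cdot> y2 = zarr T (src T y) (tgt T v')"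
    using vy y(1) by (subst (asm) (1) eta, simp add: diag_col col_zarr)+
  moreover from this(1) obtain x1 where x1: "x1 \<in> Arr T" "src T x1 = src T y" "tgt T x1 = src T u" "u \<cdot> x1 = y1"
    using exact_atE [OF e(1), of y1] by auto
  moreover from calculation(2) obtain x2 where x2: "x2 \<in> Arr T" "src T x2 = src T y" "tgt T x2 = src T u'" "u' \<cdot> x2 = y2"
    using exact_atE [OF e(2), of y2] by auto
  ultimately have "diag u u' \<cdot> col T x1 x2 = y"
    by (subst eta) (simp add: diag_col)
  then show "\<exists>x\<in>Arr T. src T x = src T y \<and> tgt T x = src T (diag u u') \<and> diag u u' \<cdot> x = y"
    using x1 x2 by (intro bexI [of _ "col T x1 x2"]) simp_all
qed

text \<open>An isomorphism together with its inverse is a retraction of sequences. This accounts for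
  the factor \<open>shsum\<close> in the last map of a sum of triangles.\<close>

lemma exact_at_cmp_iso:
  assumes e: "exact_at u v" and i: "is_iso T i" "src T i = tgt T v"
  shows "exact_at u (i \<cdot> v)"
proof -
  have [simp]: "u \<in> Arr T" "v \<in> Arr T" "tgt T u = src T v"
    using e by (auto simp: exact_at_def)
  obtain j where [simp]: "i \<in> Arr T" "j \<in> Arr T" "src T j = tgt T i" "tgt T j = src T i"
    and ij: "i \<cdot> j = ident T (tgt T i)" "j \<cdot> i = ident T (src T i)"
    using i(1) by (rule is_isoE)
  note [simp] = i(2)
  show ?thesis
    by (rule exact_at_retract [OF e, of _ _ "ident T (src T u)" "ident T (src T v)" j "ident T (src T u)" "ident T (src T v)" i])
      (simp_all add: ij cmp_reassoc [OF ij(2)])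
qed

lemma exact_at_iso_cmp:
  assumes e: "exact_at u (v \<cdot> i)" and i: "is_iso T i" "tgt T i = src T v" "v \<in> Arr T"
  shows "exact_at (i \<cdot> u) v"
proof -
  obtain j where [simp]: "i \<in> Arr T" "j \<in> Arr T" "src T j = tgt T i" "tgt T j = src T i"
    and ij: "i \<cdot> j = ident T (tgt T i)" "j \<cdot> i = ident T (src T i)"
    using i(1) by (rule is_isoE)
  note [simp] = i(2,3)
  have [simp]: "u \<in> Arr T" "tgt T u = src T i"
    using e by (auto simp: exact_at_def)
  show ?thesis
    by (rule exact_at_retract [OF e, of _ _ "ident T (src T u)" j "ident T (tgt T v)" "ident T (src T u)" i "ident T (tgt T v)"])
      (simp_all add: ij cmp_reassoc [OF ij(2)])
qed

lemma sh_diag_shsum: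
  assumes [simp]: "a \<in> Arr T" "b \<in> Arr T" "src T a = A" "src T b = B"
  shows "sh T (diag a b) \<cdot> shsum T A B = shsum T (tgt T a) (tgt T b) \<cdot> diag (sh T a) (sh T b)"
proof -
  have [simp]: "A \<in> Obj T" "B \<in> Obj T"
    using src_in_Obj assms by blast+
  show ?thesis
    by (simp add: diag_def mat_def)
qed

text \<open>Fill-ins over the two projections, from an exact triangle on \<open>diag u u'\<close> to
  the two summands, assemble into a column. It is a map to the direct sum over identities, hence an
  isomorphism by the five lemma.\<close>

lemma Tri_diag:
  assumes "(u, v, w) \<in> Tri T" "(u', v', w') \<in> Tri T"
  shows "(diag u u', diag v v', shsum T (src T u) (src T u') \<cdot> diag w w') \<in> Tri T"
proof -
  note t [simp] = TriD [OF assms(1)] and t' [simp] = TriD [OF assms(2)]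
  let ?w = "shsum T (src T u) (src T u') \<cdot> diag w w'"
  have e: "exact_at u v" "exact_at v w" "exact_at w (sh T u)" "exact_at u' v'" "exact_at v' w'" "exact_at w' (sh T u')"
    using assms [THEN Tri_pretriangle] by (auto simp: pretriangle_def)
  have cand: "(diag u u', diag v v', ?w) \<in> candidates T"
    by (simp add: candidates_iff)
  have "exact_at (diag v v') ?w"
    by (rule exact_at_cmp_iso) (simp_all add: e exact_at_diag is_iso_shsum)
  moreover have "exact_at ?w (sh T (diag u u'))"
  proof (rule exact_at_iso_cmp)
    show "exact_at (diag w w') (sh T (diag u u') \<cdot> shsum T (src T u) (src T u'))"
      by (simp add: sh_diag_shsum, rule exact_at_cmp_iso) (simp_all add: e exact_at_diag is_iso_shsum)
  qed (simp_all add: is_iso_shsum)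
  ultimately have pt: "pretriangle (diag u u') (diag v v') ?w"
    using cand by (simp add: pretriangle_def e exact_at_diag)
  obtain q r where qr: "(diag u u', q, r) \<in> Tri T"
    using Tri_extend [of "diag u u'"] by auto
  have [simp]: "q \<in> Arr T" "r \<in> Arr T" "src T q = src T v \<oplus> src T v'" "tgt T q = src T r"
    "tgt T r = shO T (src T u \<oplus> src T u')"
    using TriD [OF qr] by auto
  obtain k where k [simp]: "k \<in> Arr T" "src T k = src T r" "tgt T k = src T w"
    and kc: "k \<cdot> q = v \<cdot> prl T (src T v) (src T v')" "sh T (prl T (src T u) (src T u')) \<cdot> r = w \<cdot> k"
    using Tri_fill [OF qr assms(1), of "prl T (src T u) (src T u')" "prl T (src T v) (src T v')"]
    by (auto simp: Hom_iff diag_def matrix_simps)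
  obtain k' where k' [simp]: "k' \<in> Arr T" "src T k' = src T r" "tgt T k' = src T w'"
    and kc': "k' \<cdot> q = v' \<cdot> prr T (src T v) (src T v')" "sh T (prr T (src T u) (src T u')) \<cdot> r = w' \<cdot> k'"
    using Tri_fill [OF qr assms(2), of "prr T (src T u) (src T u')" "prr T (src T v) (src T v')"]
    by (auto simp: Hom_iff diag_def matrix_simps)
  have m: "tri_map T (diag u u', q, r) (diag u u', diag v v', ?w)
     (ident T (src T u \<oplus> src T u'), ident T (src T v \<oplus> src T v'), col T k k')"
  proof -
    have "col T k k' \<cdot> q = diag v v'"
      by (simp add: kc(1) kc'(1)) (simp add: diag_def matrix_simps)
    moreover have "?w \<cdot> col T k k' = r"
      using shsum_eta [of r "src T u" "src T u'"] by (simp add: diag_col flip: kc(2) kc'(2))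
    ultimately show ?thesis
      by (simp add: Hom_iff)
  qed
  have "is_iso T (col T k k')"
    by (rule five_lemma [OF Tri_pretriangle [OF qr] pt m]) simp_all
  then show ?thesis
    by (intro Tri_iso [OF qr cand m]) simp_all
qed

lemma Tri_cmp_zeros:
  assumes "(u, v, w) \<in> Tri T"
  shows "v \<cdot> u = zarr T (src T u) (tgt T v)" "w \<cdot> v = zarr T (src T v) (tgt T w)"
    "sh T u \<cdot> w = zarr T (src T w) (tgt T (sh T u))"
  using Tri_pretriangle [OF assms] exact_at_zero by (auto simp: pretriangle_def)

text \<open>The cancellation law used to discard the contractible summand of a cone: inclusion and
  projection exhibit the first summand as a retract of the sum.\<close>

lemma Tri_diag_iff:
  assumes d: "(u', v', w') \<in> Tri T" and cand: "(u, v, w) \<in> candidates T"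
  shows "(diag u u', diag v v', shsum T (src T u) (src T u') \<cdot> diag w w') \<in> Tri T \<longleftrightarrow> (u, v, w) \<in> Tri T"
proof
  note t' [simp] = TriD [OF d]
  have t [simp]: "u \<in> Arr T" "v \<in> Arr T" "w \<in> Arr T" "tgt T u = src T v" "tgt T v = src T w"
    "tgt T w = shO T (src T u)"
    using cand by (auto simp: candidates_iff)
  show "(u, v, w) \<in> Tri T" if *: "(diag u u', diag v v', shsum T (src T u) (src T u') \<cdot> diag w w') \<in> Tri T"
    by (rule Tri_retract [OF * cand, of "inl T (src T u) (src T u')" "inl T (src T v) (src T v')" "inl T (src T w) (src T w')"
          "prl T (src T u) (src T u')" "prl T (src T v) (src T v')" "prl T (src T w) (src T w')"])
      (simp_all add: Hom_iff diag_def matrix_simps)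
qed (simp add: Tri_diag d)

section \<open>Contractible and split triangles\<close>

lemma sh_zobj_zarr:
  assumes "f \<in> Arr T" "src T f = shO T (zobj T)"
  shows "f = zarr T (shO T (zobj T)) (tgt T f)"
proof -
  have "ident T (shO T (zobj T)) = zarr T (shO T (zobj T)) (shO T (zobj T))"
    by (simp flip: sh_ident)
  then have "f \<cdot> ident T (shO T (zobj T)) = f \<cdot> zarr T (shO T (zobj T)) (shO T (zobj T))"
    by simp
  then show ?thesis
    using assms by simp
qed

lemma is_iso_zarr_sh_zobj: "is_iso T (zarr T (zobj T) (shO T (zobj T)))"
  by (rule is_isoI [of _ "zarr T (shO T (zobj T)) (zobj T)"])
    (use sh_zobj_zarr [of "ident T (shO T (zobj T))"] in simp_all)

text \<open>An inverse rotation of A = A -> 0. The third object has to be a shift, so 0 is first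
  replaced by the isomorphic object \<Sigma>0.\<close>

lemma Tri_zobj_ident:
  assumes [simp]: "A \<in> Obj T"
  shows "(zarr T (zobj T) A, ident T A, zarr T A (shO T (zobj T))) \<in> Tri T"
proof -
  have "(ident T A, zarr T A (shO T (zobj T)), zarr T (shO T (zobj T)) (shO T A)) \<in> Tri T"
    by (rule Tri_iso [OF Tri_ident, of A _ "ident T A" "ident T A" "zarr T (zobj T) (shO T (zobj T))"])
      (simp_all add: candidates_iff Hom_iff is_iso_zarr_sh_zobj)
  then show ?thesis
    by (subst Tri_rotate) (simp_all add: candidates_iff)
qed

text \<open>The sum of A = A -> 0 and 0 -> B = B, with the summands 0 removed by retraction.\<close>

lemma Tri_split:
  assumes [simp]: "A \<in> Obj T" "B \<in> Obj T"
  shows "(inl T A B, prr T A B, zarr T B (shO T A)) \<in> Tri T"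
  by (rule Tri_retract [OF Tri_diag [OF Tri_ident [OF assms(1)] Tri_zobj_ident [OF assms(2)]],
        of _ _ _ "inl T A (zobj T)" "ident T (A \<oplus> B)" "inr T (zobj T) B"
        "prl T A (zobj T)" "ident T (A \<oplus> B)" "prr T (zobj T) B"])
    (simp_all add: candidates_iff Hom_iff diag_def matrix_simps shsum_zarr)

text \<open>The sign produced by rotation is absorbed by the automorphism -1 of \<Sigma>A.\<close>

lemma Tri_split_rotate:
  assumes [simp]: "A \<in> Obj T" "B \<in> Obj T"
  shows "(prr T A B, zarr T B (shO T A), sh T (inl T A B)) \<in> Tri T"
  by (rule Tri_iso [OF Tri_rotateD [OF Tri_split [OF assms]],
        of _ "ident T (A \<oplus> B)" "ident T B" "neg T (ident T (shO T A))"])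
    (simp_all add: candidates_iff Hom_iff)

lemma Tri_zobj_shift:
  assumes [simp]: "A \<in> Obj T"
  shows "(zarr T A (zobj T), zarr T (zobj T) (shO T A), ident T (shO T A)) \<in> Tri T"
  by (rule Tri_iso [OF Tri_rotateD [OF Tri_ident [OF assms]],
        of _ "ident T A" "ident T (zobj T)" "neg T (ident T (shO T A))"])
    (simp_all add: candidates_iff Hom_iff)

text \<open>The sum with 0 -> W = W. For the first triangle of part (1) and W = Y'' it computes the
  cone of the diagonal composite X -> Y \<oplus> Y'' as Z \<oplus> Y''.\<close>

lemma Tri_add_ident_right:
  assumes t: "(u, v, w) \<in> Tri T" and [simp]: "W \<in> Obj T"
  shows "(col T u (zarr T (src T u) W), diag v (ident T W), row T w (zarr T W (shO T (src T u)))) \<in> Tri T"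
proof -
  note [simp] = TriD [OF t]
  show ?thesis
    by (rule Tri_retract [OF Tri_diag [OF t Tri_zobj_ident [OF assms(2)]],
        of _ _ _ "inl T (src T u) (zobj T)" "ident T (src T v \<oplus> W)" "ident T (src T w \<oplus> W)"
        "prl T (src T u) (zobj T)" "ident T (src T v \<oplus> W)" "ident T (src T w \<oplus> W)"])
      (simp_all add: candidates_iff Hom_iff diag_def matrix_simps shsum_zarr)
qed

text \<open>The same sum in the other order, which is the order in the triangle of condition (c) of
  part (1) when c = 0.\<close>

lemma Tri_add_ident_left:
  assumes t: "(u, v, w) \<in> Tri T" and [simp]: "W \<in> Obj T"
  shows "(col T (zarr T (src T u) W) u, diag (ident T W) v, row T (zarr T W (shO T (src T u))) w) \<in> Tri T"
proof -
  note [simp] = TriD [OF t]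
  show ?thesis
    by (rule Tri_retract [OF Tri_diag [OF Tri_zobj_ident [OF assms(2)] t],
        of _ _ _ "inr T (zobj T) (src T u)" "ident T (W \<oplus> src T v)" "ident T (W \<oplus> src T w)"
        "prr T (zobj T) (src T u)" "ident T (W \<oplus> src T v)" "ident T (W \<oplus> src T w)"])
      (simp_all add: candidates_iff Hom_iff diag_def matrix_simps shsum_zarr)
qed

text \<open>The sum with W -> 0 -> \<Sigma>W. For W = X it computes the cone of the diagonal
  composite X \<oplus> X'' -> Y'' of part (2) as \<Sigma>X \<oplus> Z''.\<close>

lemma Tri_add_shift_left:
  assumes t: "(u, v, w) \<in> Tri T" and [simp]: "W \<in> Obj T"
  shows "(row T (zarr T W (src T v)) u, col T (zarr T (src T v) (shO T W)) v,
    shsum T W (src T u) \<cdot> diag (ident T (shO T W)) w) \<in> Tri T"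
proof -
  note [simp] = TriD [OF t]
  show ?thesis
    by (rule Tri_retract [OF Tri_diag [OF Tri_zobj_shift [OF assms(2)] t],
        of _ _ _ "ident T (W \<oplus> src T u)" "inr T (zobj T) (src T v)" "ident T (shO T W \<oplus> src T w)"
        "ident T (W \<oplus> src T u)" "prr T (zobj T) (src T v)" "ident T (shO T W \<oplus> src T w)"])
      (simp_all add: candidates_iff Hom_iff diag_def matrix_simps shsum_zarr)
qed

end

section \<open>Inclusions and projections of summands\<close>

locale block_triangle = triangulated_category T
  for T :: "('o, 'a, 'm) tricat_scheme" (structure) +
  fixes X X'' Y Y'' Z' u c u'' v\<^sub>1' v\<^sub>2' w\<^sub>1' w\<^sub>2'
  assumes homs: "u \<in> Hom T X Y" "c \<in> Hom T X'' Y" "u'' \<in> Hom T X'' Y''"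
      "v\<^sub>1' \<in> Hom T Y Z'" "v\<^sub>2' \<in> Hom T Y'' Z'"
      "w\<^sub>1' \<in> Hom T Z' (shO T X)" "w\<^sub>2' \<in> Hom T Z' (shO T X'')"
    and block: "(mat T u c (zarr T X Y'') u'', row T v\<^sub>1' v\<^sub>2', shsum T X X'' \<cdot> col T w\<^sub>1' w\<^sub>2') \<in> Tri T"
begin

abbreviation (input) "t' \<equiv> (mat T u c (zarr T X Y'') u'', row T v\<^sub>1' v\<^sub>2', shsum T X X'' \<cdot> col T w\<^sub>1' w\<^sub>2')"

lemma block_typing [simp]:
  "u \<in> Arr T" "src T u = X" "tgt T u = Y" "c \<in> Arr T" "src T c = X''" "tgt T c = Y"
  "u'' \<in> Arr T" "src T u'' = X''" "tgt T u'' = Y''"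
  "v\<^sub>1' \<in> Arr T" "src T v\<^sub>1' = Y" "tgt T v\<^sub>1' = Z'" "v\<^sub>2' \<in> Arr T" "src T v\<^sub>2' = Y''" "tgt T v\<^sub>2' = Z'"
  "w\<^sub>1' \<in> Arr T" "src T w\<^sub>1' = Z'" "tgt T w\<^sub>1' = shO T X"
  "w\<^sub>2' \<in> Arr T" "src T w\<^sub>2' = Z'" "tgt T w\<^sub>2' = shO T X''"
  using homs by (simp_all add: Hom_iff)

lemma block_objs [simp]: "X \<in> Obj T" "X'' \<in> Obj T" "Y \<in> Obj T" "Y'' \<in> Obj T" "Z' \<in> Obj T"
  using src_in_Obj [of u] src_in_Obj [of u''] tgt_in_Obj [of u] tgt_in_Obj [of u''] tgt_in_Obj [of v\<^sub>1']
  by simp_all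

text \<open>Entrywise form of the three vanishing composites of the block triangle. The two
  relations with two terms are what lets row operations clear the blocks containing c.\<close>

lemma block_zeros: 
  "v\<^sub>1' \<cdot> u = zarr T X Z'" "(v\<^sub>1' \<cdot> c) \<boxplus> (v\<^sub>2' \<cdot> u'') = zarr T X'' Z'"
  "w\<^sub>1' \<cdot> v\<^sub>1' = zarr T Y (shO T X)" "w\<^sub>1' \<cdot> v\<^sub>2' = zarr T Y'' (shO T X)"
  "w\<^sub>2' \<cdot> v\<^sub>1' = zarr T Y (shO T X'')" "w\<^sub>2' \<cdot> v\<^sub>2' = zarr T Y'' (shO T X'')"
  "(sh T u \<cdot> w\<^sub>1') \<boxplus> (sh T c \<cdot> w\<^sub>2') = zarr T Z' (shO T Y)" "sh T u'' \<cdot> w\<^sub>2' = zarr T Z' (shO T Y'')"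
  using Tri_cmp_zeros [OF block] by (simp_all add: matrix_simps shsum_zarr)

lemma v\<^sub>2'_u'' [simp]: "v\<^sub>2' \<cdot> u'' = neg T (v\<^sub>1' \<cdot> c)"
  by (rule neg_unique) (simp_all add: block_zeros)

lemma sh_c_w\<^sub>2' [simp]: "sh T c \<cdot> w\<^sub>2' = neg T (sh T u \<cdot> w\<^sub>1')"
  by (rule neg_unique) (simp_all add: block_zeros)

lemmas block_eqs [simp] = block_zeros(1,3-6,8)
lemmas block_reassoc [simp] = v\<^sub>2'_u'' [THEN cmp_reassoc] sh_c_w\<^sub>2' [THEN cmp_reassoc] block_eqs [THEN cmp_reassoc]

end

section \<open>Part (1): the map of inclusions\<close>

locale inclusion_map = block_triangle +
  fixes Z v w h
  assumes inc_homs: "v \<in> Hom T Y Z" "w \<in> Hom T Z (shO T X)" "h \<in> Hom T Z Z'"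
    and t: "(u, v, w) \<in> Tri T"
    and map: "tri_map T (u, v, w)
      (mat T u c (zarr T X Y'') u'', row T v\<^sub>1' v\<^sub>2', shsum T X X'' \<cdot> col T w\<^sub>1' w\<^sub>2')
      (inl T X X'', inl T Y Y'', h)"
begin

abbreviation (input) "m \<equiv> (inl T X X'', inl T Y Y'', h)"
abbreviation (input) "s \<equiv> (col T (v \<cdot> c) u'', row T h v\<^sub>2', w\<^sub>2')"

lemma inc_typing [simp]:
  "v \<in> Arr T" "src T v = Y" "tgt T v = Z" "w \<in> Arr T" "src T w = Z" "tgt T w = shO T X"
  "h \<in> Arr T" "src T h = Z" "tgt T h = Z'"
  using inc_homs by (simp_all add: Hom_iff)

lemma Z_Obj [simp]: "Z \<in> Obj T"
  using tgt_in_Obj [of v] by simp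

lemma t_zeros [simp]: "v \<cdot> u = zarr T X Z" "w \<cdot> v = zarr T Y (shO T X)" "sh T u \<cdot> w = zarr T Z (shO T Y)"
  using Tri_cmp_zeros [OF t] by simp_all

text \<open>All the information about \<open>h\<close> in the map of triangles: one equation from
  the second square and, by components, two from the third.\<close>

lemma inc_eqs [simp]:
  "h \<cdot> v = v\<^sub>1'" "w\<^sub>1' \<cdot> h = w" "w\<^sub>2' \<cdot> h = zarr T Z (shO T X'')"
  using map by (simp_all add: Hom_iff matrix_simps)

lemmas inc_reassoc [simp] = t_zeros [THEN cmp_reassoc] inc_eqs [THEN cmp_reassoc]

lemma s_candidate: "s \<in> candidates T"
  by (simp add: candidates_iff)

text \<open>The identities of X, Y and \<Sigma>X inside the cone form the rotated split triangle X
  \<oplus> Y -> Y -> \<Sigma>X. The entry -v is cleared against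
  \<open>h \<cdot> v = v\<^sub>1'\<close>, the entry -w against
  \<open>w\<^sub>1' \<cdot> h = w\<close>, and the shift of \<open>u\<close> against the last row of
  the block relations.\<close>

lemma good_iff: "good T (u, v, w) t' m \<longleftrightarrow> s \<in> Tri T"
proof -
  txt \<open>In coordinates, \<open>\<phi>\<^sub>1 (x, x'', y) = (x'', (x, u x + c x'' + y))\<close>,
    \<open>\<phi>\<^sub>2 (y, y'', z) = ((z + v y, y''), y)\<close> and \<open>\<phi>\<^sub>3 (z', x) = (z', x + w\<^sub>1' z')\<close>.\<close>
  let ?\<phi>\<^sub>1 = "col T (row T (row T (zarr T X X'') (ident T X'')) (zarr T Y X''))
    (col T (row T (row T (ident T X) (zarr T X'' X)) (zarr T Y X)) (row T (row T u c) (ident T Y)))"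
  let ?\<psi>\<^sub>1 = "col T (col T (row T (zarr T X'' X) (row T (ident T X) (zarr T Y X)))
      (row T (ident T X'') (zarr T (X \<oplus> Y) X'')))
    (row T (neg T c) (row T (neg T u) (ident T Y)))"
  let ?\<phi>\<^sub>2 = "col T (col T (row T (row T v (zarr T Y'' Z)) (ident T Z))
      (row T (row T (zarr T Y Y'') (ident T Y'')) (zarr T Z Y'')))
    (row T (row T (ident T Y) (zarr T Y'' Y)) (zarr T Z Y))"
  let ?\<psi>\<^sub>2 = "col T (col T (row T (zarr T (Z \<oplus> Y'') Y) (ident T Y))
      (row T (row T (zarr T Z Y'') (ident T Y'')) (zarr T Y Y'')))
    (row T (row T (ident T Z) (zarr T Y'' Z)) (neg T v))"
  let ?\<phi>\<^sub>3 = "col T (row T (ident T Z') (zarr T (shO T X) Z')) (row T w\<^sub>1' (ident T (shO T X)))"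
  let ?\<psi>\<^sub>3 = "col T (row T (ident T Z') (zarr T (shO T X) Z')) (row T (neg T w\<^sub>1') (ident T (shO T X)))"
  let ?d = "(diag (col T (v \<cdot> c) u'') (prr T X Y), diag (row T h v\<^sub>2') (zarr T Y (shO T X)),
    shsum T X'' (X \<oplus> Y) \<cdot> diag w\<^sub>2' (sh T (inl T X Y)))"
  have "?d \<in> Tri T \<longleftrightarrow> s \<in> Tri T"
    using Tri_diag_iff [OF Tri_split_rotate [of X Y] s_candidate] by simp
  moreover have "mapping_cone T (u, v, w) t' m \<in> Tri T \<longleftrightarrow> ?d \<in> Tri T"
    unfolding mapping_cone.simps
  proof (rule Tri_iso_iff [of _ _ _ _ _ _ ?\<phi>\<^sub>1 ?\<phi>\<^sub>2 ?\<phi>\<^sub>3])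
    show "is_iso T ?\<phi>\<^sub>1"
      by (rule is_isoI [of _ ?\<psi>\<^sub>1]) (simp_all add: matrix_simps)
    show "is_iso T ?\<phi>\<^sub>2"
      by (rule is_isoI [of _ ?\<psi>\<^sub>2]) (simp_all add: matrix_simps)
    show "is_iso T ?\<phi>\<^sub>3"
      by (rule is_isoI [of _ ?\<psi>\<^sub>3]) (simp_all add: matrix_simps)
  qed (simp_all add: candidates_iff Hom_iff diag_def matrix_simps shsum_zarr)
  ultimately show ?thesis
    by (simp add: good_def)
qed

lemma verdier_good_imp_s:
  assumes "verdier_good T (u, v, w) t' m"
  shows "s \<in> Tri T"
proof -
  obtain f' f'' v\<^sub>A w\<^sub>A \<alpha>\<^sub>1 \<alpha>\<^sub>2 \<beta>\<^sub>2 \<gamma>\<^sub>2 where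
    f: "(inl T X X'', f', f'') \<in> Tri T" and
    A: "(inl T Y Y'' \<cdot> u, v\<^sub>A, w\<^sub>A) \<in> Tri T" and
    \<alpha>1: "\<alpha>\<^sub>1 \<in> Hom T Z (tgt T v\<^sub>A)" "\<alpha>\<^sub>1 \<cdot> v = v\<^sub>A \<cdot> inl T Y Y''" "w\<^sub>A \<cdot> \<alpha>\<^sub>1 = w" and
    o2: "octahedron T (inl T X X'', f', f'') t' (mat T u c (zarr T X Y'') u'' \<cdot> inl T X X'', v\<^sub>A, w\<^sub>A) (\<alpha>\<^sub>2, \<beta>\<^sub>2, \<gamma>\<^sub>2)" and
    h: "h = \<beta>\<^sub>2 \<cdot> \<alpha>\<^sub>1"
    using assms by auto
  note [simp] = TriD(2,3,5,6) [OF f, simplified] TriD(2,3,5,6) [OF A, simplified]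
  have srcs [simp]: "src T f' = X \<oplus> X''" "src T v\<^sub>A = Y \<oplus> Y''"
    using TriD(4) [OF f] TriD(4) [OF A] by simp_all
  have \<alpha>1' [simp]: "\<alpha>\<^sub>1 \<in> Arr T" "src T \<alpha>\<^sub>1 = Z" "tgt T \<alpha>\<^sub>1 = src T w\<^sub>A"
    using \<alpha>1 by (simp_all add: Hom_iff)
  have o2' [simp]: "\<alpha>\<^sub>2 \<in> Arr T" "src T \<alpha>\<^sub>2 = src T f''" "tgt T \<alpha>\<^sub>2 = src T w\<^sub>A"
      "\<beta>\<^sub>2 \<in> Arr T" "src T \<beta>\<^sub>2 = src T w\<^sub>A" "tgt T \<beta>\<^sub>2 = Z'"
    and t2: "(\<alpha>\<^sub>2, \<beta>\<^sub>2, \<gamma>\<^sub>2) \<in> Tri T"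
    and o2c: "\<alpha>\<^sub>2 \<cdot> f' = v\<^sub>A \<cdot> mat T u c (zarr T X Y'') u''" "\<beta>\<^sub>2 \<cdot> v\<^sub>A = row T v\<^sub>1' v\<^sub>2'"
      "\<gamma>\<^sub>2 = sh T f' \<cdot> (shsum T X X'' \<cdot> col T w\<^sub>1' w\<^sub>2')"
    using o2 by (auto simp: Hom_iff)
  have fz: "f' \<cdot> inl T X X'' = zarr T X (src T f'')" "f'' \<cdot> f' = zarr T (X \<oplus> X'') (shO T X)"
    using Tri_cmp_zeros [OF f] by simp_all
  \<comment> \<open>Comparison of Z \<oplus> Y'' with the chosen cone of the diagonal: the first
    octahedron supplies the column on Z, and on Y'' the map is forced by compatibility with
    \<open>v\<^sub>A\<close>.\<close>
  let ?\<theta> = "row T \<alpha>\<^sub>1 (v\<^sub>A \<cdot> inr T Y Y'')"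
  let ?\<psi> = "f' \<cdot> inr T X X''"
  have "?\<theta> \<cdot> diag v (ident T Y'') = row T (v\<^sub>A \<cdot> inl T Y Y'') (v\<^sub>A \<cdot> inr T Y Y'')"
    by (simp add: diag_def mat_def \<alpha>1)
  then have "?\<theta> \<cdot> diag v (ident T Y'') = v\<^sub>A"
    by (simp add: row_eta)
  moreover have "row T w (zarr T Y'' (shO T X)) = w\<^sub>A \<cdot> ?\<theta>"
    using Tri_cmp_zeros(2) [OF A] by (simp add: \<alpha>1 cmp_reassoc)
  moreover have "col T u (zarr T X Y'') = inl T Y Y'' \<cdot> u"
    by (simp add: inl_eq_col)
  ultimately have \<theta>: "is_iso T ?\<theta>"
    by - (rule five_lemma [OF Tri_pretriangle [OF Tri_add_ident_right [OF t, of Y'']] Tri_pretriangle [OF A],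
        of "ident T X" "ident T (Y \<oplus> Y'')"], simp_all add: Hom_iff)
  have \<psi>: "is_iso T ?\<psi>"
  proof -
    \<comment> \<open>Since \<open>f'\<close> vanishes on the first summand, it factors through the
      projection; \<open>?\<psi>\<close> is thus the comparison of X'' with the chosen cone of the
      inclusion.\<close>
    have "f' \<cdot> ((inl T X X'' \<cdot> prl T X X'') \<boxplus> (inr T X X'' \<cdot> prr T X X'')) = ?\<psi> \<cdot> prr T X X''"
      by (simp add: cmp_reassoc [OF fz(1)])
    then have "?\<psi> \<cdot> prr T X X'' = f'"
      by (simp add: inl_prl_inr_prr del: cmp_madd_simp)
    then show ?thesis
    by - (rule five_lemma [OF Tri_pretriangle [OF Tri_split [of X X'']] Tri_pretriangle [OF f],
        of "ident T X" "ident T (X \<oplus> X'')"],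
      simp_all add: Hom_iff cmp_reassoc [OF fz(2)])
  qed
  have m: "tri_map T s (\<alpha>\<^sub>2, \<beta>\<^sub>2, \<gamma>\<^sub>2) (?\<psi>, ?\<theta>, ident T Z')"
  proof -
    have "\<alpha>\<^sub>2 \<cdot> ?\<psi> = v\<^sub>A \<cdot> (mat T u c (zarr T X Y'') u'' \<cdot> inr T X X'')"
      by (simp add: cmp_reassoc [OF o2c(1)])
    also have "mat T u c (zarr T X Y'') u'' \<cdot> inr T X X'' = (inl T Y Y'' \<cdot> c) \<boxplus> (inr T Y Y'' \<cdot> u'')"
      by (simp add: matrix_simps)
    also have "v\<^sub>A \<cdot> \<dots> = ?\<theta> \<cdot> col T (v \<cdot> c) u''"
      by (simp add: cmp_reassoc [OF \<alpha>1(2)])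
    finally have "?\<theta> \<cdot> col T (v \<cdot> c) u'' = \<alpha>\<^sub>2 \<cdot> ?\<psi>" ..
    \<comment> \<open>The condition \<open>h = \<beta>\<^sub>2 \<cdot> \<alpha>\<^sub>1\<close>
      enters here: it identifies the first entry of \<open>\<beta>\<^sub>2 \<cdot> ?\<theta>\<close>
      with \<open>h\<close>.\<close>
    moreover have "row T h v\<^sub>2' = \<beta>\<^sub>2 \<cdot> ?\<theta>"
      by (simp add: cmp_reassoc [OF o2c(2)] row_inr flip: h)
    moreover have "sh T ?\<psi> \<cdot> w\<^sub>2' = \<gamma>\<^sub>2"
    proof -
      \<comment> \<open>The shift of \<open>f'\<close> kills the component
        \<open>w\<^sub>1'\<close>, so only \<open>w\<^sub>2'\<close> survives in
        \<open>\<gamma>\<^sub>2\<close>.\<close>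
      have *: "sh T f' \<cdot> sh T (inl T X X'') = zarr T (shO T X) (shO T (src T f''))"
        using fz(1) by (simp flip: sh_cmp)
      show ?thesis
        by (simp add: o2c(3) shsum_col_eq cmp_reassoc [OF *])
    qed
    moreover have "src T \<gamma>\<^sub>2 = Z'" "tgt T \<gamma>\<^sub>2 = shO T (src T f'')" "\<gamma>\<^sub>2 \<in> Arr T"
      using TriD [OF t2] by simp_all
    ultimately show ?thesis
      by (simp add: Hom_iff)
  qed
  have "(\<alpha>\<^sub>2, \<beta>\<^sub>2, \<gamma>\<^sub>2) \<in> candidates T"
    using t2 Tri_candidates by blast
  from Tri_iso_iff [OF s_candidate this m \<psi> \<theta>] t2 show ?thesis
    by simp
qed

text \<open>With split triangles on both inclusions, the first octahedron is the split triangle on Z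
  and Y'', the second is \<open>s\<close>, and restricting \<open>row T h v\<^sub>2'\<close> to Z
  recovers \<open>h\<close>.\<close>

lemma s_imp_verdier_good:
  assumes "s \<in> Tri T"
  shows "verdier_good T (u, v, w) t' m"
  unfolding verdier_good.simps
proof (intro exI conjI)
  show "(inl T X X'', prr T X X'', zarr T X'' (shO T X)) \<in> Tri T"
    "(inl T Y Y'', prr T Y Y'', zarr T Y'' (shO T Y)) \<in> Tri T"
    by (simp_all add: Tri_split)
  show "(inl T Y Y'' \<cdot> u, diag v (ident T Y''), row T w (zarr T Y'' (shO T X))) \<in> Tri T"
    using Tri_add_ident_right [OF t, of Y''] by (simp add: inl_eq_col)
  show "octahedron T (u, v, w) (inl T Y Y'', prr T Y Y'', zarr T Y'' (shO T Y))
    (inl T Y Y'' \<cdot> u, diag v (ident T Y''), row T w (zarr T Y'' (shO T X)))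
    (inl T Z Y'', prr T Z Y'', zarr T Y'' (shO T Z))"
    using Tri_split [of Z Y''] by (simp add: Hom_iff) (simp add: diag_def matrix_simps)
  show "octahedron T (inl T X X'', prr T X X'', zarr T X'' (shO T X)) t'
    (mat T u c (zarr T X Y'') u'' \<cdot> inl T X X'', diag v (ident T Y''), row T w (zarr T Y'' (shO T X))) s"
    using assms by (simp add: Hom_iff) (simp add: diag_def matrix_simps shsum_zarr)
  show "h = row T h v\<^sub>2' \<cdot> inl T Z Y''"
    by (simp add: row_inl)
qed

lemma zero_imp_s:
  assumes [simp]: "c = zarr T X'' Y"
  shows "s \<in> Tri T"
proof -
  obtain v'' w'' where t'': "(u'', v'', w'') \<in> Tri T"
    using Tri_extend [of u''] by auto
  note [simp] = TriD(2,3,5,6) [OF t'', simplified]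
  have [simp]: "src T v'' = Y''"
    using TriD(4) [OF t''] by simp
  \<comment> \<open>The inclusions of the second summands commute with the first maps because c =
    0.\<close>
  have "\<exists>k. tri_map T (u'', v'', w'') t' (inr T X X'', inr T Y Y'', k)"
    by (rule Tri_fill [OF t'' block]) (simp_all add: Hom_iff matrix_simps)
  then obtain k where k [simp]: "k \<in> Arr T" "src T k = src T w''" "tgt T k = Z'"
    and km: "k \<cdot> v'' = row T v\<^sub>1' v\<^sub>2' \<cdot> inr T Y Y''"
      "sh T (inr T X X'') \<cdot> w'' = shsum T X X'' \<cdot> col T w\<^sub>1' w\<^sub>2' \<cdot> k"
    by (auto simp: Hom_iff simp del: cmp_row col_cmp)
  have [simp]: "k \<cdot> v'' = v\<^sub>2'"
    using km(1) by (simp add: row_inr)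
  have [simp]: "w\<^sub>1' \<cdot> k = zarr T (src T w'') (shO T X)" "w\<^sub>2' \<cdot> k = w''"
    using km(2) [symmetric] by (simp_all add: matrix_simps)
  have "is_iso T (row T h k)"
    by (rule five_lemma [OF Tri_pretriangle [OF Tri_diag [OF t t'']] Tri_pretriangle [OF block],
        of "ident T (X \<oplus> X'')" "ident T (Y \<oplus> Y'')"])
      (simp_all, simp add: Hom_iff diag_def matrix_simps)
  then show ?thesis
    by - (rule Tri_iso [OF Tri_add_ident_left [OF t'', of Z] s_candidate,
        of "ident T X''" "ident T (Z \<oplus> Y'')" "row T h k"],
      simp_all, simp add: Hom_iff diag_def matrix_simps)
qed

theorem equivalences:
  "(good T (u, v, w) t' m \<longleftrightarrow> verdier_good T (u, v, w) t' m) \<and>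
   (verdier_good T (u, v, w) t' m \<longleftrightarrow> s \<in> Tri T) \<and>
   (c = zarr T X'' Y \<longrightarrow> good T (u, v, w) t' m \<and> verdier_good T (u, v, w) t' m \<and> s \<in> Tri T)"
  using good_iff verdier_good_imp_s s_imp_verdier_good zero_imp_s by blast

end

section \<open>Part (2): the map of projections\<close>

locale projection_map = block_triangle +
  fixes Z'' v'' w'' h
  assumes proj_homs: "v'' \<in> Hom T Y'' Z''" "w'' \<in> Hom T Z'' (shO T X'')" "h \<in> Hom T Z' Z''"
    and t'': "(u'', v'', w'') \<in> Tri T"
    and map: "tri_map T (mat T u c (zarr T X Y'') u'', row T v\<^sub>1' v\<^sub>2', shsum T X X'' \<cdot> col T w\<^sub>1' w\<^sub>2')
      (u'', v'', w'') (prr T X X'', prr T Y Y'', h)"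
begin

abbreviation (input) "m \<equiv> (prr T X X'', prr T Y Y'', h)"
abbreviation (input) "s \<equiv> (col T w\<^sub>1' h, row T (sh T u) (sh T c \<cdot> w''), sh T v\<^sub>1')"
text \<open>The inverse rotation of \<open>s\<close>, starting at Y instead of Z'. Rotation turns
  \<open>neg T v\<^sub>1'\<close> into the last map \<open>sh T v\<^sub>1'\<close> of
  \<open>s\<close> with the correct sign.\<close>

abbreviation (input) "r \<equiv> (neg T v\<^sub>1', col T w\<^sub>1' h, row T (sh T u) (sh T c \<cdot> w''))"

lemma proj_typing [simp]:
  "v'' \<in> Arr T" "src T v'' = Y''" "tgt T v'' = Z''" "w'' \<in> Arr T" "src T w'' = Z''" "tgt T w'' = shO T X''"
  "h \<in> Arr T" "src T h = Z'" "tgt T h = Z''"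
  using proj_homs by (simp_all add: Hom_iff)

lemma Z''_Obj [simp]: "Z'' \<in> Obj T"
  using tgt_in_Obj [of v''] by simp

lemma t''_zeros [simp]:
  "v'' \<cdot> u'' = zarr T X'' Z''" "w'' \<cdot> v'' = zarr T Y'' (shO T X'')" "sh T u'' \<cdot> w'' = zarr T Z'' (shO T Y'')"
  using Tri_cmp_zeros [OF t''] by simp_all

lemma proj_eqs [simp]:
  "h \<cdot> v\<^sub>1' = zarr T Y Z''" "h \<cdot> v\<^sub>2' = v''" "w'' \<cdot> h = w\<^sub>2'"
  using map by (simp_all add: Hom_iff matrix_simps)

lemmas proj_reassoc [simp] = t''_zeros [THEN cmp_reassoc] proj_eqs [THEN cmp_reassoc]

lemma s_candidate: "s \<in> candidates T"
  by (simp add: candidates_iff)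

lemma r_candidate: "r \<in> candidates T"
  by (simp add: candidates_iff)

lemma r_iff_s: "r \<in> Tri T \<longleftrightarrow> s \<in> Tri T"
  using Tri_rotate [OF r_candidate] by simp

text \<open>The identities of X'', Y'' and \<Sigma>X'' form the contractible summand X'' \<oplus>
  Y'' -> Y'' -> \<Sigma>X'', and the complement is \<open>r\<close>. The cone contains the negatives
  of \<open>v\<^sub>1'\<close> and \<open>w\<^sub>1'\<close>: the first sign is kept in
  \<open>r\<close>, the second is removed by the entry -1 on \<Sigma>X in
  \<open>?\<phi>\<^sub>3\<close>.\<close>

lemma good_iff: "good T t' (u'', v'', w'') m \<longleftrightarrow> s \<in> Tri T"
proof -
  txt \<open>In coordinates, \<open>\<phi>\<^sub>1 (y, (x'', y'')) = (x'', (y - c x'', y'' - u'' x''))\<close>,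
    \<open>\<phi>\<^sub>2 (z', y'') = (y'', z' - v\<^sub>2' y'')\<close> and \<open>\<phi>\<^sub>3 ((x, z''), x'') = (z'', (- x, x'' - w'' z''))\<close>.\<close>
  let ?\<phi>\<^sub>1 = "col T (row T (zarr T Y X'') (row T (ident T X'') (zarr T Y'' X'')))
    (col T (row T (ident T Y) (row T (neg T c) (zarr T Y'' Y)))
      (row T (zarr T Y Y'') (row T (neg T u'') (ident T Y''))))"
  let ?\<psi>\<^sub>1 = "col T (row T c (row T (ident T Y) (zarr T Y'' Y)))
    (col T (row T (ident T X'') (zarr T (Y \<oplus> Y'') X''))
      (row T u'' (row T (zarr T Y Y'') (ident T Y''))))"
  let ?\<phi>\<^sub>2 = "col T (row T (zarr T Z' Y'') (ident T Y'')) (row T (ident T Z') (neg T v\<^sub>2'))"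
  let ?\<psi>\<^sub>2 = "col T (row T v\<^sub>2' (ident T Z')) (row T (ident T Y'') (zarr T Z' Y''))"
  let ?\<phi>\<^sub>3 = "col T (row T (row T (zarr T (shO T X) Z'') (ident T Z'')) (zarr T (shO T X'') Z''))
    (col T (row T (row T (neg T (ident T (shO T X))) (zarr T Z'' (shO T X))) (zarr T (shO T X'') (shO T X)))
      (row T (row T (zarr T (shO T X) (shO T X'')) (neg T w'')) (ident T (shO T X''))))"
  let ?\<psi>\<^sub>3 = "col T (col T (row T (zarr T Z'' (shO T X)) (row T (neg T (ident T (shO T X))) (zarr T (shO T X'') (shO T X))))
      (row T (ident T Z'') (zarr T (shO T X \<oplus> shO T X'') Z'')))
    (row T w'' (row T (zarr T (shO T X) (shO T X'')) (ident T (shO T X''))))"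
  let ?d = "(diag (neg T v\<^sub>1') (prr T X'' Y''), diag (col T w\<^sub>1' h) (zarr T Y'' (shO T X'')),
    shsum T Y (X'' \<oplus> Y'') \<cdot> diag (row T (sh T u) (sh T c \<cdot> w'')) (sh T (inl T X'' Y'')))"
  have "?d \<in> Tri T \<longleftrightarrow> r \<in> Tri T"
    using Tri_diag_iff [OF Tri_split_rotate [of X'' Y''] r_candidate] by simp
  moreover have "?d \<in> Tri T \<longleftrightarrow> mapping_cone T t' (u'', v'', w'') m \<in> Tri T"
    unfolding mapping_cone.simps
  \<comment> \<open>The third object of the cone is Z'' \<oplus> \<Sigma>(X \<oplus> X''), whereas
    \<open>?\<phi>\<^sub>3\<close> ends in Z'' \<oplus> (\<Sigma>X \<oplus> \<Sigma>X''); the extra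
    factor bridges the two.\<close>
  proof (rule Tri_iso_iff [of _ _ _ _ _ _ ?\<phi>\<^sub>1 ?\<phi>\<^sub>2 "diag (ident T Z'') (shsum T X X'') \<cdot> ?\<phi>\<^sub>3"])
    show "is_iso T ?\<phi>\<^sub>1"
      by (rule is_isoI [of _ ?\<psi>\<^sub>1]) (simp_all add: matrix_simps)
    show "is_iso T ?\<phi>\<^sub>2"
      by (rule is_isoI [of _ ?\<psi>\<^sub>2]) (simp_all add: matrix_simps)
    have "is_iso T ?\<phi>\<^sub>3"
      by (rule is_isoI [of _ ?\<psi>\<^sub>3]) (simp_all add: matrix_simps)
    then show "is_iso T (diag (ident T Z'') (shsum T X X'') \<cdot> ?\<phi>\<^sub>3)"
      by (rule is_iso_cmp) (simp_all add: is_iso_diag is_iso_shsum)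
  qed (simp_all add: candidates_iff Hom_iff diag_def matrix_simps shsum_zarr)
  ultimately show ?thesis
    by (simp add: good_def r_iff_s)
qed

lemma verdier_good_imp_s:
  assumes "verdier_good T t' (u'', v'', w'') m"
  shows "s \<in> Tri T"
proof -
  obtain g' g'' v\<^sub>A w\<^sub>A \<alpha>\<^sub>1 \<beta>\<^sub>1 \<gamma>\<^sub>1 \<alpha>\<^sub>2 \<beta>\<^sub>2 where
    g: "(prr T Y Y'', g', g'') \<in> Tri T" and
    A: "(prr T Y Y'' \<cdot> mat T u c (zarr T X Y'') u'', v\<^sub>A, w\<^sub>A) \<in> Tri T" and
    o1: "octahedron T t' (prr T Y Y'', g', g'') (prr T Y Y'' \<cdot> mat T u c (zarr T X Y'') u'', v\<^sub>A, w\<^sub>A) (\<alpha>\<^sub>1, \<beta>\<^sub>1, \<gamma>\<^sub>1)" and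
    \<beta>2: "\<beta>\<^sub>2 \<in> Hom T (tgt T v\<^sub>A) Z''" "\<beta>\<^sub>2 \<cdot> v\<^sub>A = v''" "w'' \<cdot> \<beta>\<^sub>2 = sh T (prr T X X'') \<cdot> w\<^sub>A" and
    h: "h = \<beta>\<^sub>2 \<cdot> \<alpha>\<^sub>1"
    using assms by auto
  note [simp] = TriD(2,3,5,6) [OF g, simplified] TriD(2,3,5) [OF A, simplified]
  have [simp]: "src T g' = Y''" "src T v\<^sub>A = Y''" "tgt T w\<^sub>A = shO T (X \<oplus> X'')"
    using TriD(4) [OF g] TriD(4,6) [OF A] by simp_all
  have [simp]: "\<beta>\<^sub>2 \<in> Arr T" "src T \<beta>\<^sub>2 = src T w\<^sub>A" "tgt T \<beta>\<^sub>2 = Z''"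
    using \<beta>2 by (simp_all add: Hom_iff)
  have [simp]: "\<alpha>\<^sub>1 \<in> Arr T" "src T \<alpha>\<^sub>1 = Z'" "tgt T \<alpha>\<^sub>1 = src T w\<^sub>A"
      "\<beta>\<^sub>1 \<in> Arr T" "src T \<beta>\<^sub>1 = src T w\<^sub>A" "tgt T \<beta>\<^sub>1 = src T g''"
    and t1: "(\<alpha>\<^sub>1, \<beta>\<^sub>1, \<gamma>\<^sub>1) \<in> Tri T"
    and o1c: "w\<^sub>A \<cdot> \<alpha>\<^sub>1 = shsum T X X'' \<cdot> col T w\<^sub>1' w\<^sub>2'"
      "\<gamma>\<^sub>1 = sh T (row T v\<^sub>1' v\<^sub>2') \<cdot> g''" "g'' \<cdot> \<beta>\<^sub>1 = sh T (mat T u c (zarr T X Y'') u'') \<cdot> w\<^sub>A"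
    using o1 by (auto simp: Hom_iff)
  have gz: "g'' \<cdot> g' = zarr T Y'' (shO T (Y \<oplus> Y''))" "sh T (prr T Y Y'') \<cdot> g'' = zarr T (src T g'') (shO T Y'')"
    using Tri_cmp_zeros [OF g] by simp_all
  have Az: "w\<^sub>A \<cdot> v\<^sub>A = zarr T Y'' (shO T (X \<oplus> X''))"
    using Tri_cmp_zeros(2) [OF A] by simp
  \<comment> \<open>As the shifted projection to \<Sigma>Y'' kills \<open>g''\<close>, this map
    factors through \<Sigma>Y; the factor \<open>?\<psi>\<close> compares the chosen cone of the
    projection with \<Sigma>Y.\<close>
  have g''_eta: "sh T (inl T Y Y'') \<cdot> (sh T (prl T Y Y'') \<cdot> g'') = g''"
  proof -
    have "((sh T (inl T Y Y'') \<cdot> sh T (prl T Y Y'')) \<boxplus> (sh T (inr T Y Y'') \<cdot> sh T (prr T Y Y''))) \<cdot> g''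
        = sh T (inl T Y Y'') \<cdot> (sh T (prl T Y Y'') \<cdot> g'')"
      by (simp add: gz)
    then show ?thesis
      by (simp add: sh_prl_inl_prr_inr del: madd_cmp_simp)
  qed
  \<comment> \<open>Now a map out of the chosen cone: the second octahedron supplies the component
    to Z'', and \<open>w\<^sub>A\<close> forces the one to \<Sigma>X.\<close>
  let ?\<theta> = "col T (sh T (prl T X X'') \<cdot> w\<^sub>A) \<beta>\<^sub>2"
  let ?\<psi> = "sh T (prl T Y Y'') \<cdot> g''"
  have "?\<theta> \<cdot> v\<^sub>A = col T (zarr T Y'' (shO T X)) v''"
    by (simp add: \<beta>2 Az)
  moreover have "(shsum T X X'' \<cdot> diag (ident T (shO T X)) w'') \<cdot> ?\<theta> = w\<^sub>A"
    using shsum_eta [of w\<^sub>A X X''] by (simp add: diag_col \<beta>2)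
  moreover have "prr T Y Y'' \<cdot> mat T u c (zarr T X Y'') u'' = row T (zarr T X Y'') u''"
    by (simp add: matrix_simps)
  ultimately have \<theta>: "is_iso T ?\<theta>"
    by - (rule five_lemma [OF Tri_pretriangle [OF A] Tri_pretriangle [OF Tri_add_shift_left [OF t'', of X]],
        of "ident T (X \<oplus> X'')" "ident T Y''"], simp_all add: Hom_iff)
  have \<psi>: "is_iso T ?\<psi>"
    by (rule five_lemma [OF Tri_pretriangle [OF g] Tri_pretriangle [OF Tri_split_rotate [of Y Y'']],
        of "ident T (Y \<oplus> Y'')" "ident T Y''"])
      (simp_all add: Hom_iff g''_eta gz)
  have m: "tri_map T (\<alpha>\<^sub>1, \<beta>\<^sub>1, \<gamma>\<^sub>1) s (ident T Z', ?\<theta>, ?\<psi>)"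
  proof -
    \<comment> \<open>The second entry is where
      \<open>h = \<beta>\<^sub>2 \<cdot> \<alpha>\<^sub>1\<close> is used.\<close>
    have "?\<theta> \<cdot> \<alpha>\<^sub>1 = col T w\<^sub>1' h"
      by (simp add: o1c sh_proj_shsum flip: h)
    moreover have "?\<psi> \<cdot> \<beta>\<^sub>1 = row T (sh T u) (sh T c \<cdot> w'') \<cdot> ?\<theta>"
    proof -
      have "?\<psi> \<cdot> \<beta>\<^sub>1 = sh T (prl T Y Y'' \<cdot> mat T u c (zarr T X Y'') u'') \<cdot> w\<^sub>A"
        by (simp add: o1c)
      also have "prl T Y Y'' \<cdot> mat T u c (zarr T X Y'') u'' = (u \<cdot> prl T X X'') \<boxplus> (c \<cdot> prr T X X'')"
        by (simp add: matrix_simps)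
      \<comment> \<open>The last identity of the second octahedron replaces the \<Sigma>X''
        component of \<open>w\<^sub>A\<close> by \<open>w'' \<cdot> \<beta>\<^sub>2\<close>.\<close>
      also have "sh T \<dots> \<cdot> w\<^sub>A = row T (sh T u) (sh T c \<cdot> w'') \<cdot> ?\<theta>"
        by (simp add: \<beta>2)
      finally show ?thesis .
    qed
    moreover have "\<gamma>\<^sub>1 = sh T v\<^sub>1' \<cdot> ?\<psi>"
    proof -
      have "row T v\<^sub>1' v\<^sub>2' = (v\<^sub>1' \<cdot> prl T Y Y'') \<boxplus> (v\<^sub>2' \<cdot> prr T Y Y'')"
        by (simp add: row_def)
      then show ?thesis
        by (simp add: o1c gz)
    qed
    moreover have "src T \<gamma>\<^sub>1 = src T g''" "tgt T \<gamma>\<^sub>1 = shO T Z'" "\<gamma>\<^sub>1 \<in> Arr T"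
      using TriD [OF t1] by simp_all
    ultimately show ?thesis
      by (simp add: Hom_iff)
  qed
  show ?thesis
    by (rule Tri_iso [OF t1 s_candidate m _ \<theta> \<psi>]) simp
qed

text \<open>The roles are exchanged compared with the inclusions: \<open>s\<close> is the first
  octahedron, and the second is the split triangle on \<Sigma>X and Z''. The second component of
  \<open>col T w\<^sub>1' h\<close> is \<open>h\<close>.\<close>

lemma s_imp_verdier_good:
  assumes "s \<in> Tri T"
  shows "verdier_good T t' (u'', v'', w'') m"
  unfolding verdier_good.simps
proof (intro exI conjI)
  let ?a = "(prr T Y Y'' \<cdot> mat T u c (zarr T X Y'') u'', col T (zarr T Y'' (shO T X)) v'',
    shsum T X X'' \<cdot> diag (ident T (shO T X)) w'')"
  show "(prr T X X'', zarr T X'' (shO T X), sh T (inl T X X'')) \<in> Tri T"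
    "(prr T Y Y'', zarr T Y'' (shO T Y), sh T (inl T Y Y'')) \<in> Tri T"
    by (simp_all add: Tri_split_rotate)
  have "prr T Y Y'' \<cdot> mat T u c (zarr T X Y'') u'' = row T (zarr T X Y'') u''"
    by (simp add: matrix_simps)
  then show "?a \<in> Tri T"
    using Tri_add_shift_left [OF t'', of X] by simp
  show "octahedron T t' (prr T Y Y'', zarr T Y'' (shO T Y), sh T (inl T Y Y'')) ?a s"
    using assms by (simp add: Hom_iff) (simp add: diag_def matrix_simps shsum_zarr)
  show "octahedron T (prr T X X'', zarr T X'' (shO T X), sh T (inl T X X'')) (u'', v'', w'')
    (u'' \<cdot> prr T X X'', col T (zarr T Y'' (shO T X)) v'', shsum T X X'' \<cdot> diag (ident T (shO T X)) w'')
    (inl T (shO T X) Z'', prr T (shO T X) Z'', zarr T Z'' (shO T (shO T X)))"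
    using Tri_split [of "shO T X" Z''] by (simp add: Hom_iff) (simp add: diag_def matrix_simps shsum_zarr)
  show "h = prr T (shO T X) Z'' \<cdot> col T w\<^sub>1' h"
    by (simp add: prr_col)
qed

lemma zero_imp_s:
  assumes [simp]: "c = zarr T X'' Y"
  shows "s \<in> Tri T"
proof -
  obtain v w where t: "(u, v, w) \<in> Tri T"
    using Tri_extend [of u] by auto
  note [simp] = TriD(2,3,5,6) [OF t, simplified]
  have [simp]: "src T v = Y"
    using TriD(4) [OF t] by simp
  \<comment> \<open>The projections to the first summands commute with the first maps because c =
    0.\<close>
  have "\<exists>k. tri_map T t' (u, v, w) (prl T X X'', prl T Y Y'', k)"
    by (rule Tri_fill [OF block t]) (simp_all add: Hom_iff matrix_simps)
  then obtain k where k [simp]: "k \<in> Arr T" "src T k = Z'" "tgt T k = src T w"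
    and km: "k \<cdot> row T v\<^sub>1' v\<^sub>2' = v \<cdot> prl T Y Y''"
      "sh T (prl T X X'') \<cdot> (shsum T X X'' \<cdot> col T w\<^sub>1' w\<^sub>2') = w \<cdot> k"
    by (auto simp: Hom_iff simp del: cmp_row)
  have [simp]: "k \<cdot> v\<^sub>1' = v" "k \<cdot> v\<^sub>2' = zarr T Y'' (src T w)"
    using km(1) by (simp_all add: matrix_simps)
  have [simp]: "w \<cdot> k = w\<^sub>1'"
    using km(2) [symmetric] by (simp add: matrix_simps)
  have iso: "is_iso T (col T k h)"
    by (rule five_lemma [OF Tri_pretriangle [OF block] Tri_pretriangle [OF Tri_diag [OF t t'']],
        of "ident T (X \<oplus> X'')" "ident T (Y \<oplus> Y'')"])
      (simp_all, simp add: Hom_iff diag_def matrix_simps)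
  \<comment> \<open>The automorphism -1 of Y moves the sign of the rotation from the last map to the
    first, where \<open>r\<close> has it.\<close>
  have "(neg T v, w, sh T u) \<in> Tri T"
    by (rule Tri_iso [OF Tri_rotateD [OF t], of _ "neg T (ident T Y)" "ident T (src T w)" "ident T (shO T X)"])
      (simp_all, simp_all add: candidates_iff Hom_iff)
  from Tri_add_ident_right [OF this, of Z'']
  have *: "(col T (neg T v) (zarr T Y Z''), diag w (ident T Z''), row T (sh T u) (zarr T Z'' (shO T Y))) \<in> Tri T"
    by simp
  have "tri_map T r (col T (neg T v) (zarr T Y Z''), diag w (ident T Z''), row T (sh T u) (zarr T Z'' (shO T Y)))
    (ident T Y, col T k h, ident T (shO T X \<oplus> Z''))"
    by (simp add: Hom_iff diag_col)
  from Tri_iso_iff [OF r_candidate _ this _ iso] * Tri_candidates have "r \<in> Tri T"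
    by auto
  then show ?thesis
    using r_iff_s by simp
qed

theorem equivalences:
  "(good T t' (u'', v'', w'') m \<longleftrightarrow> verdier_good T t' (u'', v'', w'') m) \<and>
   (verdier_good T t' (u'', v'', w'') m \<longleftrightarrow> s \<in> Tri T) \<and>
   (c = zarr T X'' Y \<longrightarrow> good T t' (u'', v'', w'') m \<and> verdier_good T t' (u'', v'', w'') m \<and> s \<in> Tri T)"
  using good_iff verdier_good_imp_s s_imp_verdier_good zero_imp_s by blast

end

theorem proposition5p1:
  fixes T :: "('o, 'a, 'm) tricat_scheme" (structure)
  assumes "triangulated_category T"
  shows
    "(\<forall>X X'' Y Y'' Z Z' u v w c u'' v\<^sub>1' v\<^sub>2' w\<^sub>1' w\<^sub>2' h.
        u \<in> Hom T X Y \<and> v \<in> Hom T Y Z \<and> w \<in> Hom T Z (shO T X) \<and>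
        c \<in> Hom T X'' Y \<and> u'' \<in> Hom T X'' Y'' \<and>
        v\<^sub>1' \<in> Hom T Y Z' \<and> v\<^sub>2' \<in> Hom T Y'' Z' \<and>
        w\<^sub>1' \<in> Hom T Z' (shO T X) \<and> w\<^sub>2' \<in> Hom T Z' (shO T X'') \<and>
        h \<in> Hom T Z Z' \<longrightarrow>
        (let t = (u, v, w);
             t' = (mat T u c (zarr T X Y'') u'', row T v\<^sub>1' v\<^sub>2', shsum T X X'' \<cdot> col T w\<^sub>1' w\<^sub>2');
             m = (inl T X X'', inl T Y Y'', h);
             s = (col T (v \<cdot> c) u'', row T h v\<^sub>2', w\<^sub>2')
         in t \<in> Tri T \<longrightarrow> t' \<in> Tri T \<longrightarrow> tri_map T t t' m \<longrightarrow>
            (good T t t' m \<longleftrightarrow> verdier_good T t t' m) \<and>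
            (verdier_good T t t' m \<longleftrightarrow> s \<in> Tri T) \<and>
            (c = zarr T X'' Y \<longrightarrow> good T t t' m \<and> verdier_good T t t' m \<and> s \<in> Tri T))) \<and>
     (\<forall>X X'' Y Y'' Z' Z'' u c u'' v\<^sub>1' v\<^sub>2' w\<^sub>1' w\<^sub>2' v'' w'' h.
        u \<in> Hom T X Y \<and> c \<in> Hom T X'' Y \<and> u'' \<in> Hom T X'' Y'' \<and>
        v\<^sub>1' \<in> Hom T Y Z' \<and> v\<^sub>2' \<in> Hom T Y'' Z' \<and>
        w\<^sub>1' \<in> Hom T Z' (shO T X) \<and> w\<^sub>2' \<in> Hom T Z' (shO T X'') \<and>
        v'' \<in> Hom T Y'' Z'' \<and> w'' \<in> Hom T Z'' (shO T X'') \<and>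
        h \<in> Hom T Z' Z'' \<longrightarrow>
        (let t' = (mat T u c (zarr T X Y'') u'', row T v\<^sub>1' v\<^sub>2', shsum T X X'' \<cdot> col T w\<^sub>1' w\<^sub>2');
             t'' = (u'', v'', w'');
             m = (prr T X X'', prr T Y Y'', h);
             s = (col T w\<^sub>1' h, row T (sh T u) (sh T c \<cdot> w''), sh T v\<^sub>1')
         in t' \<in> Tri T \<longrightarrow> t'' \<in> Tri T \<longrightarrow> tri_map T t' t'' m \<longrightarrow>
            (good T t' t'' m \<longleftrightarrow> verdier_good T t' t'' m) \<and>
            (verdier_good T t' t'' m \<longleftrightarrow> s \<in> Tri T) \<and>
            (c = zarr T X'' Y \<longrightarrow> good T t' t'' m \<and> verdier_good T t' t'' m \<and> s \<in> Tri T)))"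
proof -
  interpret triangulated_category T
    by fact
  show ?thesis
  proof (rule conjI; intro allI impI)
    fix X X'' Y Y'' Z Z' u v w c u'' v\<^sub>1' v\<^sub>2' w\<^sub>1' w\<^sub>2' h
    assume homs: "u \<in> Hom T X Y \<and> v \<in> Hom T Y Z \<and> w \<in> Hom T Z (shO T X) \<and>
        c \<in> Hom T X'' Y \<and> u'' \<in> Hom T X'' Y'' \<and>
        v\<^sub>1' \<in> Hom T Y Z' \<and> v\<^sub>2' \<in> Hom T Y'' Z' \<and>
        w\<^sub>1' \<in> Hom T Z' (shO T X) \<and> w\<^sub>2' \<in> Hom T Z' (shO T X'') \<and>
        h \<in> Hom T Z Z'"
    show "let t = (u, v, w);
             t' = (mat T u c (zarr T X Y'') u'', row T v\<^sub>1' v\<^sub>2', shsum T X X'' \<cdot> col T w\<^sub>1' w\<^sub>2');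
             m = (inl T X X'', inl T Y Y'', h);
             s = (col T (v \<cdot> c) u'', row T h v\<^sub>2', w\<^sub>2')
         in t \<in> Tri T \<longrightarrow> t' \<in> Tri T \<longrightarrow> tri_map T t t' m \<longrightarrow>
            (good T t t' m \<longleftrightarrow> verdier_good T t t' m) \<and>
            (verdier_good T t t' m \<longleftrightarrow> s \<in> Tri T) \<and>
            (c = zarr T X'' Y \<longrightarrow> good T t t' m \<and> verdier_good T t t' m \<and> s \<in> Tri T)"
      unfolding Let_def
      by (intro impI inclusion_map.equivalences [where Z' = Z' and Z = Z]; unfold_locales; use homs in blast)
  next
    fix X X'' Y Y'' Z' Z'' u c u'' v\<^sub>1' v\<^sub>2' w\<^sub>1' w\<^sub>2' v'' w'' h
    assume homs: "u \<in> Hom T X Y \<and> c \<in> Hom T X'' Y \<and> u'' \<in> Hom T X'' Y'' \<and>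
        v\<^sub>1' \<in> Hom T Y Z' \<and> v\<^sub>2' \<in> Hom T Y'' Z' \<and>
        w\<^sub>1' \<in> Hom T Z' (shO T X) \<and> w\<^sub>2' \<in> Hom T Z' (shO T X'') \<and>
        v'' \<in> Hom T Y'' Z'' \<and> w'' \<in> Hom T Z'' (shO T X'') \<and>
        h \<in> Hom T Z' Z''"
    show "let t' = (mat T u c (zarr T X Y'') u'', row T v\<^sub>1' v\<^sub>2', shsum T X X'' \<cdot> col T w\<^sub>1' w\<^sub>2');
             t'' = (u'', v'', w'');
             m = (prr T X X'', prr T Y Y'', h);
             s = (col T w\<^sub>1' h, row T (sh T u) (sh T c \<cdot> w''), sh T v\<^sub>1')
         in t' \<in> Tri T \<longrightarrow> t'' \<in> Tri T \<longrightarrow> tri_map T t' t'' m \<longrightarrow>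
            (good T t' t'' m \<longleftrightarrow> verdier_good T t' t'' m) \<and>
            (verdier_good T t' t'' m \<longleftrightarrow> s \<in> Tri T) \<and>
            (c = zarr T X'' Y \<longrightarrow> good T t' t'' m \<and> verdier_good T t' t'' m \<and> s \<in> Tri T)"
      unfolding Let_def
      by (intro impI projection_map.equivalences [where Z' = Z' and Z'' = Z'']; unfold_locales; use homs in blast)
  qed
qed

end
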